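(* Let $d\in\{0,1,2\}$ and let $\overline m=(m_0,m_1,\dots)$ be any bounded sequence of integers $m_i\ge 2$. Then the Schreier graph $\mathcal G_{d,\overline m}$ of the action of the mother group $\mathcal M_{d,\overline m}$ on $\mathcal E_0$ is recurrent.
   Context: Let $\overline m=(m_0,m_1,\dots)$ be a bounded sequence of integers $m_i\ge2$. $T_{\overline m}$ is the rooted spherically symmetric tree in which each vertex at level $i$ has $m_i$ children. Its ends are encoded by infinite sequences $x=\dots x_2x_1x_0$ with $x_i\in\{0,1,\dots,m_i-1\}$. $\mathcal E_0$ is the set of ends with only finitely many nonzero digits. For an end $x$ let $\ell_{-1}(x)=-1$ and inductively $\ell_t(x)=\inf\{n>\ell_{t-1}(x): x_n\ne 0\}$ (with $\inf\emptyset=\infty$). The mother group $\mathcal M_{d,\overline m}$ of degree $d$ is the group of automorphisms of $T_{\overline m}$ generated by the following generators: each is specified by $t\in\{-1,0,\dots,d\}$ and a sequence $(\sigma_i)_{i\le\max\overline m}$ with $\sigma_i\in S_i$ a permutation of $\{0,\dots,i-1\}$. Given an end $x$, let $k=1+\ell_t(x)$; the generator applies $\sigma_{m_k}$ to the digit $x_k$ and leaves all other digits unchanged (if $k=\infty$, $x$ is fixed). These generators preserve $\mathcal E_0$. The Schreier graph for the action of a group generated by $S$ on a set $A$ is the (undirected) graph with vertex set $A$ and an edge $(x,x\sigma)$ for every $x\in A$, $\sigma\in S$. $\mathcal G_{d,\overline m}$ is the Schreier graph of the action of $\mathcal M_{d,\overline m}$, with the generators above, on $\mathcal E_0$; it is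 connected. A connected graph is recurrent if simple random walk on it is recurrent. *)

theory Defs
  imports
    "HOL-Probability.Probability"
    "HOL-Algebra.Group_Action"
    "HOL-Algebra.Generated_Groups"
    "HOL-Combinatorics.Permutations"
    "Graph_Theory.Digraph"
begin

section \<open>Ends of the spherically symmetric tree\<close>

definition ends :: "(nat \<Rightarrow> nat) \<Rightarrow> (nat \<Rightarrow> nat) set" where
  "ends m = {x. \<forall>i. x i < m i}"

definition finitary_ends :: "(nat \<Rightarrow> nat) \<Rightarrow> (nat \<Rightarrow> nat) set" where
  "finitary_ends m = {x \<in> ends m. finite {i. x i \<noteq> 0}}"

text \<open>
  The position \<open>\<ell>\<^sub>t(x)\<close> of a nonzero digit, for an integer \<open>t \<ge> -1\<close>, with value \<open>\<infinity>\<close> if there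
  are not enough nonzero digits (in \<^typ>\<open>ereal\<close>, the infimum of the empty set is \<open>\<infinity>\<close>).
  Indices \<open>t < -1\<close> do not occur.
\<close>

function ell :: "(nat \<Rightarrow> nat) \<Rightarrow> int \<Rightarrow> ereal" where
  "ell x t = (if t \<le> -1 then -1
     else Inf {ereal (real n) | n. ell x (t - 1) < ereal (real n) \<and> x n \<noteq> 0})"
  by auto
termination
  by (relation "Wellfounded.measure (\<lambda>(x, t). nat (t + 1))") auto

declare ell.simps [simp del]


section \<open>The mother group\<close>

text \<open>
  Tree automorphisms are represented by the bijections of the set of ends they induce, extensional
  as in \<^const>\<open>BijGroup\<close>. If \<open>1 + \<ell>\<^sub>t(x) = \<infinity>\<close> then no digit changes.
\<close>

definition mother_generator ::
  "(nat \<Rightarrow> nat) \<Rightarrow> int \<Rightarrow> (nat \<Rightarrow> nat \<Rightarrow> nat) \<Rightarrow> (nat \<Rightarrow> nat) \<Rightarrow> nat \<Rightarrow> nat" where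
  "mother_generator m t \<sigma> =
     (\<lambda>x\<in>ends m. \<lambda>k. if ereal (real k) = 1 + ell x t then \<sigma> (m k) (x k) else x k)"

definition mother_generators ::
  "nat \<Rightarrow> (nat \<Rightarrow> nat) \<Rightarrow> ((nat \<Rightarrow> nat) \<Rightarrow> nat \<Rightarrow> nat) set" where
  "mother_generators d m =
     {mother_generator m t \<sigma> | t \<sigma>.
        t \<in> {-1..int d} \<and> (\<forall>i \<le> Max (range m). \<sigma> i permutes {..<i})}"

definition mother_group :: "nat \<Rightarrow> (nat \<Rightarrow> nat) \<Rightarrow> ((nat \<Rightarrow> nat) \<Rightarrow> nat \<Rightarrow> nat) monoid" where
  "mother_group d m =
     BijGroup (ends m) \<lparr>carrier := generate (BijGroup (ends m)) (mother_generators d m)\<rparr>"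


section \<open>Schreier graphs\<close>

text \<open>
  A multigraph with one edge for each pair \<open>(x, s)\<close>. It is an undirected graph: the orientation
  of the arcs only names the two ends of an edge and plays no role in the random walk below.
\<close>

definition schreier_graph ::
  "'g set \<Rightarrow> ('g \<Rightarrow> 'a \<Rightarrow> 'a) \<Rightarrow> 'a set \<Rightarrow> ('a, 'a \<times> 'g) pre_digraph" where
  "schreier_graph S \<phi> A =
     \<lparr>verts = A, arcs = A \<times> S, tail = fst, head = (\<lambda>(x, s). \<phi> s x)\<rparr>"

definition mother_schreier_graph ::
  "nat \<Rightarrow> (nat \<Rightarrow> nat) \<Rightarrow>
    (nat \<Rightarrow> nat, (nat \<Rightarrow> nat) \<times> ((nat \<Rightarrow> nat) \<Rightarrow> nat \<Rightarrow> nat)) pre_digraph" where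
  "mother_schreier_graph d m = schreier_graph (mother_generators d m) (\<lambda>g x. g x) (finitary_ends m)"


section \<open>Simple random walk and recurrence\<close>

text \<open>
  One step of simple random walk on the undirected multigraph underlying a locally finite graph
  without isolated vertices: choose uniformly one of the edge ends at \<open>v\<close> (an outgoing or an
  incoming arc; a loop has two ends at \<open>v\<close>) and cross that edge.
\<close>

definition srw_step :: "('a, 'b) pre_digraph \<Rightarrow> 'a \<Rightarrow> 'a pmf" where
  "srw_step G v =
     map_pmf (case_sum (head G) (tail G)) (pmf_of_set (out_arcs G v <+> in_arcs G v))"

text \<open>
  The law on trajectories of simple random walk started at \<open>v\<close>, as the Ionescu-Tulcea measure of
  the kernels giving the position at time \<open>n\<close> from the positions before time \<open>n\<close>. See
  \<open>srw_measure_cylinder\<close> below for its finite-dimensional distributions.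
\<close>

definition srw_kernel :: "('a, 'b) pre_digraph \<Rightarrow> 'a \<Rightarrow> nat \<Rightarrow> (nat \<Rightarrow> 'a) \<Rightarrow> 'a measure" where
  "srw_kernel G v n \<omega> =
     measure_pmf (case n of 0 \<Rightarrow> return_pmf v | Suc k \<Rightarrow> srw_step G (\<omega> k))"

definition srw_measure :: "('a, 'b) pre_digraph \<Rightarrow> 'a \<Rightarrow> (nat \<Rightarrow> 'a) measure" where
  "srw_measure G v =
     projective_family.lim UNIV
       (Ionescu_Tulcea.CI (srw_kernel G v) (\<lambda>_. count_space UNIV)) (\<lambda>_. count_space UNIV)"

text \<open>
  Quantifying over all starting points, so that no root has to be chosen; on a connected graph this
  is equivalent to the same condition at a single vertex.
\<close>

definition recurrent_graph :: "('a, 'b) pre_digraph \<Rightarrow> bool" where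
  "recurrent_graph G \<longleftrightarrow> (\<forall>v \<in> verts G. AE \<omega> in srw_measure G v. \<exists>n>0. \<omega> n = v)"


section \<open>Well-definedness\<close>

subsection \<open>The trajectory measure\<close>

lemma Ionescu_Tulcea_srw:
  fixes G :: "('a, 'b) pre_digraph"
  shows "Ionescu_Tulcea (srw_kernel G v) (\<lambda>_. count_space UNIV)"
proof -
  have "srw_kernel G v i \<in> measurable (PiM {0..<i} (\<lambda>_. count_space UNIV))
          (subprob_algebra (count_space UNIV))" for i
  proof (cases i)
    case 0
    then show ?thesis
      by (auto simp: srw_kernel_def[abs_def] space_subprob_algebra
          intro!: measurable_const prob_space_imp_subprob_space prob_space_measure_pmf)
  next
    case (Suc k)
    have 1: "(\<lambda>\<omega>. \<omega> k) \<in> measurable (PiM {0..<i} (\<lambda>_. count_space UNIV)) (count_space UNIV)"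
      using Suc by (intro measurable_component_singleton) auto
    have 2: "(\<lambda>y. measure_pmf (srw_step G y))
        \<in> measurable (count_space UNIV) (subprob_algebra (count_space UNIV))"
      by (auto simp: space_subprob_algebra
          intro!: prob_space_imp_subprob_space prob_space_measure_pmf)
    show ?thesis
      using measurable_compose[OF 1 2] Suc by (simp add: srw_kernel_def[abs_def])
  qed
  moreover have "prob_space (srw_kernel G v i x)" for i x
    by (simp add: srw_kernel_def prob_space_measure_pmf)
  ultimately show ?thesis
    by (rule Ionescu_Tulcea.intro)
qed

lemma sets_srw_measure: "sets (srw_measure G v) = sets (PiM UNIV (\<lambda>_. count_space UNIV))"
proof -
  interpret IT: Ionescu_Tulcea "srw_kernel G v" "\<lambda>_. count_space UNIV"
    by (rule Ionescu_Tulcea_srw)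
  show ?thesis unfolding srw_measure_def by simp
qed

lemma srw_measure_cylinder:
  fixes G :: "('a, 'b) pre_digraph"
  shows
  "emeasure (srw_measure G v) {\<omega>. \<forall>i\<le>n. \<omega> i = xs i} =
     ennreal (indicator {v} (xs 0) * (\<Prod>i<n. pmf (srw_step G (xs i)) (xs (Suc i))))"
proof -
  interpret IT: Ionescu_Tulcea "srw_kernel G v" "\<lambda>_. count_space UNIV"
    by (rule Ionescu_Tulcea_srw)
  let ?M = "\<lambda>_::nat. count_space (UNIV :: 'a set)"
  let ?r = "\<lambda>n. restrict xs {0..<n}"
  let ?C = "\<lambda>n. IT.C 0 n (\<lambda>_. undefined)"
  have sing: "{?r k} \<in> sets (PiM {0..<k} ?M)" for k
  proof -
    have "{?r k} = (\<Pi>\<^sub>E i\<in>{0..<k}. {xs i})"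
    proof -
      have "{?r k} = (\<Pi>\<^sub>E i\<in>{0..<k}. {?r k i})"
        by (rule PiE_singleton[symmetric]) simp
      also have "\<dots> = (\<Pi>\<^sub>E i\<in>{0..<k}. {xs i})"
        by (rule PiE_cong) simp
      finally show ?thesis .
    qed
    then show ?thesis by (auto intro!: sets_PiM_I_finite)
  qed
  have u: "(\<lambda>_. undefined) \<in> space (PiM {0..<0} ?M)"
    by (simp add: space_PiM)
  have step: "emeasure (?C (Suc k)) {?r (Suc k)} =
      emeasure (?C k) {?r k} * emeasure (srw_kernel G v k (?r k)) {xs k}" for k
  proof -
    have meas: "IT.eP k \<in> measurable (?C k) (subprob_algebra (PiM {0..<Suc k} ?M))"
      using IT.measurable_eP[of k] by (simp add: measurable_cong_sets[OF IT.sets_C[OF u] refl])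
    have eP: "emeasure (IT.eP k \<omega>) {?r (Suc k)} =
        emeasure (srw_kernel G v k (?r k)) {xs k} * indicator {?r k} \<omega>"
      if \<omega>: "\<omega> \<in> space (PiM {0..<k} ?M)" for \<omega>
    proof -
      have "emeasure (IT.eP k \<omega>) {?r (Suc k)} =
          emeasure (srw_kernel G v k \<omega>) ((\<lambda>y. fun_upd \<omega> k y) -` {?r (Suc k)} \<inter> UNIV)"
        using IT.emeasure_eP[OF \<omega> sing] by simp
      also have "(\<lambda>y. fun_upd \<omega> k y) -` {?r (Suc k)} \<inter> UNIV = (if \<omega> = ?r k then {xs k} else {})"
      proof -
        have ext: "\<omega> \<in> extensional {0..<k}" using \<omega> by (auto simp: space_PiM PiE_def)
        have "fun_upd \<omega> k y = ?r (Suc k) \<longleftrightarrow> \<omega> = ?r k \<and> y = xs k" for y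
        proof
          assume *: "fun_upd \<omega> k y = ?r (Suc k)"
          have "\<omega> i = ?r k i" for i
            using fun_cong[OF *, of i] ext
            by (cases "i = k") (auto simp: extensional_def restrict_def split: if_splits)
          moreover have "y = xs k" using fun_cong[OF *, of k] by simp
          ultimately show "\<omega> = ?r k \<and> y = xs k" by auto
        qed (auto simp: restrict_def fun_eq_iff)
        then show ?thesis by auto
      qed
      finally show ?thesis
        by (cases "\<omega> = ?r k") (simp_all del: restrict_apply)
    qed
    have "emeasure (?C (Suc k)) {?r (Suc k)} =
        (\<integral>\<^sup>+\<omega>. emeasure (IT.eP k \<omega>) {?r (Suc k)} \<partial>?C k)"
      using emeasure_bind[OF _ meas sing] u by (auto simp: IT.space_C)
    also have "\<dots> = (\<integral>\<^sup>+\<omega>. emeasure (srw_kernel G v k (?r k)) {xs k} * indicator {?r k} \<omega> \<partial>?C k)"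
      by (intro nn_integral_cong eP) (simp add: IT.space_C[OF u])
    also have "\<dots> = emeasure (srw_kernel G v k (?r k)) {xs k} * emeasure (?C k) {?r k}"
      using sing[of k] by (intro nn_integral_cmult_indicator) (simp add: IT.sets_C[OF u])
    finally show ?thesis by (simp add: mult.commute)
  qed
  have main: "emeasure (?C (Suc k)) {?r (Suc k)} =
      ennreal (indicator {v} (xs 0) * (\<Prod>i<k. pmf (srw_step G (xs i)) (xs (Suc i))))" for k
  proof (induction k)
    case 0
    have "emeasure (?C 0) {?r 0} = 1"
      using sing[of 0] by (simp add: emeasure_return restrict_def)
    then show ?case
      unfolding step[of 0]
      by (auto simp: srw_kernel_def emeasure_pmf_single indicator_def)
  next
    case (Suc k)
    show ?case
      unfolding step[of "Suc k"] Suc.IH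
      by (simp add: srw_kernel_def emeasure_pmf_single ennreal_mult[symmetric] prod_nonneg
          mult.assoc)
  qed
  have "{\<omega>. \<forall>i\<le>n. \<omega> i = xs i} = IT.PF.emb UNIV {0..<Suc n} {?r (Suc n)}"
    by (auto simp: prod_emb_def restrict_def fun_eq_iff less_Suc_eq_le) metis
  then have "emeasure (srw_measure G v) {\<omega>. \<forall>i\<le>n. \<omega> i = xs i} =
      emeasure (IT.CI {0..<Suc n}) {?r (Suc n)}"
    unfolding srw_measure_def using IT.lim[OF _ sing] by simp
  also have "\<dots> = emeasure (?C (Suc n)) {?r (Suc n)}"
    using IT.emeasure_CI[OF subset_refl sing] by (simp add: prod_emb_id space_PiM)
  finally show ?thesis using main by simp
qed

lemma prob_space_srw_measure:
  fixes G :: "('a, 'b) pre_digraph"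
  shows "prob_space (srw_measure G v)"
proof -
  interpret IT: Ionescu_Tulcea "srw_kernel G v" "\<lambda>_. count_space UNIV"
    by (rule Ionescu_Tulcea_srw)
  interpret CI: prob_space "IT.CI {0}"
    by (rule IT.PF.prob_space_P) auto
  let ?M = "\<lambda>_::nat. count_space (UNIV :: 'a set)"
  have "emeasure (srw_measure G v) (IT.PF.emb UNIV {0} (space (PiM {0} ?M))) =
      emeasure (IT.CI {0}) (space (PiM {0} ?M))"
    unfolding srw_measure_def by (rule IT.lim) auto
  also have "\<dots> = 1"
    using CI.emeasure_space_1 by (simp add: IT.CI_def)
  also have "IT.PF.emb UNIV {0} (space (PiM {0} ?M)) = space (srw_measure G v)"
    using sets_eq_imp_space_eq[OF sets_srw_measure[of G v]]
    by (auto simp: prod_emb_def space_PiM)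
  finally show ?thesis by (intro prob_spaceI)
qed


subsection \<open>The generators\<close>

lemma ell_alt:
  assumes "-1 \<le> t"
  shows "ell x t = \<infinity> \<or> (\<exists>k::nat. ell x t = ereal (real k - 1))"
proof (cases "t = -1")
  case True
  then show ?thesis
    by (intro disjI2 exI[of _ 0]) (simp add: ell.simps one_ereal_def)
next
  case False
  define A where "A = {n. ell x (t - 1) < ereal (real n) \<and> x n \<noteq> 0}"
  have eq: "ell x t = Inf ((\<lambda>n. ereal (real n)) ` A)"
    using assms False by (subst ell.simps) (auto simp: A_def image_def intro!: arg_cong[of _ _ Inf])
  show ?thesis
  proof (cases "A = {}")
    case True
    then show ?thesis using eq by (simp add: top_ereal_def)
  next
    case False
    define n where "n = (LEAST n. n \<in> A)"
    have n: "n \<in> A" "\<And>k. k \<in> A \<Longrightarrow> n \<le> k"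
      using False unfolding n_def by (auto intro: LeastI Least_le)
    have "ell x t = ereal (real n)"
      unfolding eq using n by (intro cInf_eq_minimum) auto
    then show ?thesis by (intro disjI2 exI[of _ "Suc n"]) simp
  qed
qed

lemma ell_minus_1: "ereal (real k) = 1 + ell x (-1) \<longleftrightarrow> k = 0"
  by (simp add: ell.simps one_ereal_def)

lemma ell_rec:
  assumes "0 \<le> t"
  shows "ereal (real k) = 1 + ell x t \<longleftrightarrow>
    (\<exists>j n. k = Suc n \<and> ereal (real j) = 1 + ell x (t - 1) \<and> j \<le> n \<and> x n \<noteq> 0 \<and> (\<forall>i\<in>{j..<n}. x i = 0))"
proof -
  define A where "A = {n. ell x (t - 1) < ereal (real n) \<and> x n \<noteq> 0}"
  have eq: "ell x t = Inf ((\<lambda>n. ereal (real n)) ` A)"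
    using assms by (subst ell.simps) (auto simp: A_def image_def intro!: arg_cong[of _ _ Inf])
  consider "ell x (t - 1) = \<infinity>" | j where "ell x (t - 1) = ereal (real j - 1)"
    using ell_alt[of "t - 1" x] assms by auto
  then show ?thesis
  proof cases
    case 1
    then have "A = {}" by (auto simp: A_def)
    then show ?thesis using 1 eq by (simp add: top_ereal_def)
  next
    case (2 j)
    have A: "A = {n. j \<le> n \<and> x n \<noteq> 0}"
      unfolding A_def 2 by auto
    have j: "ereal (real j') = 1 + ell x (t - 1) \<longleftrightarrow> j' = j" for j'
      by (simp add: 2 one_ereal_def)
    show ?thesis
    proof (cases "A = {}")
      case True
      then have "\<not> (j \<le> n \<and> x n \<noteq> 0)" for n using A by auto
      moreover have "ell x t = \<infinity>" using eq True by (simp add: top_ereal_def)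
      ultimately show ?thesis unfolding j by auto
    next
      case False
      define n where "n = (LEAST n. n \<in> A)"
      have n: "n \<in> A" "\<And>k. k \<in> A \<Longrightarrow> n \<le> k"
        using False unfolding n_def by (auto intro: LeastI Least_le)
      have "ell x t = ereal (real n)"
        unfolding eq using n by (intro cInf_eq_minimum) auto
      then have "ereal (real k) = 1 + ell x t \<longleftrightarrow> k = Suc n"
        by (auto simp: one_ereal_def)
      also have "k = Suc n \<longleftrightarrow> (\<exists>n. k = Suc n \<and> j \<le> n \<and> x n \<noteq> 0 \<and> (\<forall>i\<in>{j..<n}. x i = 0))"
      proof
        assume "k = Suc n"
        have "x i = 0" if "i \<in> {j..<n}" for i
        proof (rule ccontr)
          assume "x i \<noteq> 0"
          then have "i \<in> A" using that by (simp add: A)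
          then have "n \<le> i" by (rule n(2))
          then show False using that by simp
        qed
        then show "\<exists>n. k = Suc n \<and> j \<le> n \<and> x n \<noteq> 0 \<and> (\<forall>i\<in>{j..<n}. x i = 0)"
          using \<open>k = Suc n\<close> n(1) by (auto simp: A)
      next
        assume "\<exists>n. k = Suc n \<and> j \<le> n \<and> x n \<noteq> 0 \<and> (\<forall>i\<in>{j..<n}. x i = 0)"
        then obtain n' where n': "k = Suc n'" "j \<le> n'" "x n' \<noteq> 0" "\<forall>i\<in>{j..<n'}. x i = 0"
          by auto
        have "n \<le> n'" using n' by (intro n(2)) (simp add: A)
        moreover have "\<not> n < n'" using n' n(1) by (auto simp: A)
        ultimately show "k = Suc n" using n' by simp
      qed
      finally show ?thesis unfolding j by simp
    qed
  qed
qed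

lemma ell_prefix:
  assumes "-1 \<le> t" "\<And>i. i < k \<Longrightarrow> x i = y i"
  shows "ereal (real k) = 1 + ell x t \<longleftrightarrow> ereal (real k) = 1 + ell y t"
  using assms
proof (induction t arbitrary: k rule: int_ge_induct)
  case base
  then show ?case by (simp only: ell_minus_1)
next
  case (step t)
  have IH: "ereal (real j) = 1 + ell x t \<longleftrightarrow> ereal (real j) = 1 + ell y t" if "j \<le> k" for j
    using step.IH[of j] step.prems that by auto
  have pos: "0 \<le> t + 1" using step.hyps by simp
  have t: "t + 1 - 1 = t" by simp
  have "(k = Suc n \<and> ereal (real j) = 1 + ell x t \<and> j \<le> n \<and> x n \<noteq> 0 \<and> (\<forall>i\<in>{j..<n}. x i = 0)) \<longleftrightarrow>
      (k = Suc n \<and> ereal (real j) = 1 + ell y t \<and> j \<le> n \<and> y n \<noteq> 0 \<and> (\<forall>i\<in>{j..<n}. y i = 0))" for j n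
    using IH[of j] step.prems by auto
  then show ?case
    by (simp only: ell_rec[OF pos] t)
qed

lemma ell_unique:
  "ereal (real k) = 1 + ell x t \<Longrightarrow> ereal (real k') = 1 + ell x t \<Longrightarrow> k = k'"
  by (metis ereal.inject of_nat_eq_iff)

lemma ell_generator:
  assumes "-1 \<le> t" "x \<in> ends m"
  shows "ereal (real k) = 1 + ell (mother_generator m t \<sigma> x) t \<longleftrightarrow> ereal (real k) = 1 + ell x t"
proof (cases "\<exists>k0. ereal (real k0) = 1 + ell x t")
  case True
  then obtain k0 where k0: "ereal (real k0) = 1 + ell x t" by auto
  have "ereal (real k0) = 1 + ell (mother_generator m t \<sigma> x) t"
    using k0 assms
    by (subst ell_prefix[where y = x]) (auto simp: mother_generator_def dest: ell_unique)
  then show ?thesis using k0 by (metis ell_unique)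
next
  case False
  then have "mother_generator m t \<sigma> x = x"
    using assms by (auto simp: mother_generator_def)
  then show ?thesis by simp
qed

lemma mother_generator_in_ends:
  assumes "\<And>i. \<sigma> (m i) permutes {..<m i}" "x \<in> ends m"
  shows "mother_generator m t \<sigma> x \<in> ends m"
  using assms permutes_in_image[OF assms(1)]
  by (auto simp: mother_generator_def ends_def)

lemma mother_generator_inverse:
  assumes "-1 \<le> t" "\<And>i. \<sigma> (m i) permutes {..<m i}" "x \<in> ends m"
  shows "mother_generator m t (\<lambda>i. inv_into UNIV (\<sigma> i)) (mother_generator m t \<sigma> x) = x"
proof
  fix k
  show "mother_generator m t (\<lambda>i. inv_into UNIV (\<sigma> i)) (mother_generator m t \<sigma> x) k = x k"
    using mother_generator_in_ends[of \<sigma> m x t] assms permutes_inverses(2)[OF assms(2)]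
    by (subst mother_generator_def) (auto simp: ell_generator, auto simp: mother_generator_def)
qed

context
  fixes d :: nat and m :: "nat \<Rightarrow> nat"
  assumes m_bounded: "bdd_above (range m)"
begin

lemma finite_range_m: "finite (range m)"
  using m_bounded by (simp add: bdd_above_nat)

lemma mother_generators_cases:
  assumes "g \<in> mother_generators d m"
  obtains t \<sigma> where "g = mother_generator m t \<sigma>" "-1 \<le> t" "t \<le> int d"
    "\<And>i. \<sigma> (m i) permutes {..<m i}"
proof -
  obtain t \<sigma> where *: "g = mother_generator m t \<sigma>" "t \<in> {-1..int d}"
    "\<forall>i \<le> Max (range m). \<sigma> i permutes {..<i}"
    using assms unfolding mother_generators_def by blast
  have "m i \<le> Max (range m)" for i
    using finite_range_m by (intro Max_ge) auto
  then show ?thesis using that[of t \<sigma>] * by auto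
qed

lemma mother_generators_Bij:
  assumes "g \<in> mother_generators d m"
  shows "g \<in> Bij (ends m)"
proof -
  obtain t \<sigma> where g: "g = mother_generator m t \<sigma>" "-1 \<le> t"
    and \<sigma>: "\<And>i. \<sigma> (m i) permutes {..<m i}"
    using mother_generators_cases[OF assms] by metis
  have \<sigma>': "\<And>i. inv_into UNIV (\<sigma> (m i)) permutes {..<m i}"
    using \<sigma> by (rule permutes_inv)
  have [simp]: "inv_into UNIV (inv_into UNIV (\<sigma> (m i))) = \<sigma> (m i)" for i
    using \<sigma>[of i] by (rule permutes_inv_inv)
  have eq: "mother_generator m t (\<lambda>i. inv_into UNIV (inv_into UNIV (\<sigma> i))) = mother_generator m t \<sigma>"
    by (simp add: mother_generator_def cong: if_cong)
  let ?h = "mother_generator m t (\<lambda>i. inv_into UNIV (\<sigma> i))"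
  have "?h (g x) = x" if "x \<in> ends m" for x
    unfolding g using g(2) \<sigma> that by (rule mother_generator_inverse)
  moreover have "g (?h x) = x" if "x \<in> ends m" for x
    using mother_generator_inverse[of t "\<lambda>i. inv_into UNIV (\<sigma> i)" m x] g(2) \<sigma>' that
    unfolding eq g by blast
  moreover have "g x \<in> ends m" if "x \<in> ends m" for x
    unfolding g using \<sigma> that by (rule mother_generator_in_ends)
  moreover have "?h x \<in> ends m" if "x \<in> ends m" for x
    using \<sigma>' that by (rule mother_generator_in_ends)
  ultimately have "bij_betw g (ends m) (ends m)"
    by (intro bij_betw_byWitness[where f' = ?h]) auto
  then show ?thesis
    by (simp add: Bij_def g mother_generator_def)
qed

lemma mother_generators_prefix:
  assumes "g \<in> mother_generators d m" "x \<in> ends m" "y \<in> ends m"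
  shows "(\<forall>i<n. g x i = g y i) \<longleftrightarrow> (\<forall>i<n. x i = y i)"
proof -
  obtain t \<sigma> where g: "g = mother_generator m t \<sigma>" "-1 \<le> t"
    and \<sigma>: "\<And>i. \<sigma> (m i) permutes {..<m i}"
    using mother_generators_cases[OF assms(1)] by metis
  have pres: "\<forall>i<n. mother_generator m t \<tau> u i = mother_generator m t \<tau> w i"
    if "u \<in> ends m" "w \<in> ends m" "\<forall>i<n. u i = w i" for u w \<tau>
  proof (intro allI impI)
    fix i assume i: "i < n"
    have "ereal (real i) = 1 + ell u t \<longleftrightarrow> ereal (real i) = 1 + ell w t"
      using that i by (intro ell_prefix[OF g(2)]) auto
    then show "mother_generator m t \<tau> u i = mother_generator m t \<tau> w i"
      using that i by (simp add: mother_generator_def)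
  qed
  show ?thesis
  proof
    assume "\<forall>i<n. g x i = g y i"
    let ?h = "mother_generator m t (\<lambda>i. inv_into UNIV (\<sigma> i))"
    have "?h (g z) = z" if "z \<in> ends m" for z
      unfolding g using g(2) \<sigma> that by (rule mother_generator_inverse)
    moreover have "g z \<in> ends m" if "z \<in> ends m" for z
      unfolding g using \<sigma> that by (rule mother_generator_in_ends)
    ultimately show "\<forall>i<n. x i = y i"
      using pres[of "g x" "g y" "\<lambda>i. inv_into UNIV (\<sigma> i)"] \<open>\<forall>i<n. g x i = g y i\<close> assms(2,3)
      by metis
  next
    assume "\<forall>i<n. x i = y i"
    then show "\<forall>i<n. g x i = g y i"
      unfolding g using assms(2,3) by (intro pres)
  qed
qed

lemma mother_generators_finitary_iff:
  assumes "g \<in> mother_generators d m" "x \<in> ends m"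
  shows "g x \<in> finitary_ends m \<longleftrightarrow> x \<in> finitary_ends m"
proof -
  obtain t \<sigma> where g: "g = mother_generator m t \<sigma>" "-1 \<le> t"
    using mother_generators_cases[OF assms(1)] by metis
  define D where "D = {k. ereal (real k) = 1 + ell x t}"
  have "\<exists>k. D \<subseteq> {k}"
    by (auto simp: D_def dest: ell_unique)
  then have D: "finite D" by (meson finite.simps finite_subset)
  have "{i. g x i \<noteq> 0} \<subseteq> {i. x i \<noteq> 0} \<union> D" "{i. x i \<noteq> 0} \<subseteq> {i. g x i \<noteq> 0} \<union> D"
    using assms(2) by (auto simp: g mother_generator_def D_def)
  then have "finite {i. g x i \<noteq> 0} \<longleftrightarrow> finite {i. x i \<noteq> 0}"
    using D by (meson finite_UnI finite_subset)
  moreover have "g x \<in> ends m"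
    using mother_generators_Bij[OF assms(1)] assms(2) by (auto dest: Bij_imp_funcset)
  ultimately show ?thesis using assms(2) by (simp add: finitary_ends_def)
qed

lemma finite_mother_generators: "finite (mother_generators d m)"
proof -
  let ?\<Sigma> = "\<Pi>\<^sub>E i\<in>{..Max (range m)}. {p. p permutes {..<i}}"
  have le: "m i \<le> Max (range m)" for i
    using finite_range_m by (intro Max_ge) auto
  have "mother_generators d m \<subseteq> (\<lambda>(t, \<sigma>). mother_generator m t \<sigma>) ` ({-1..int d} \<times> ?\<Sigma>)"
  proof
    fix g assume "g \<in> mother_generators d m"
    then obtain t \<sigma> where *: "g = mother_generator m t \<sigma>" "t \<in> {-1..int d}"
      "\<forall>i \<le> Max (range m). \<sigma> i permutes {..<i}"
      unfolding mother_generators_def by blast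
    have "g = mother_generator m t (restrict \<sigma> {..Max (range m)})"
      using le by (simp add: * mother_generator_def cong: if_cong)
    then show "g \<in> (\<lambda>(t, \<sigma>). mother_generator m t \<sigma>) ` ({-1..int d} \<times> ?\<Sigma>)"
      using * by (intro image_eqI[of _ _ "(t, restrict \<sigma> {..Max (range m)})"]) auto
  qed
  moreover have "finite ({-1..int d} \<times> ?\<Sigma>)"
    by (intro finite_cartesian_product finite_PiE) (auto intro: finite_permutations)
  ultimately show ?thesis by (meson finite_imageI finite_subset)
qed

lemma mother_generators_nonempty: "mother_generators d m \<noteq> {}"
proof -
  have "mother_generator m (-1) (\<lambda>_. id) \<in> mother_generators d m"
    unfolding mother_generators_def
    by (intro CollectI exI[of _ "-1"] exI[of _ "\<lambda>_. id"] conjI allI impI permutes_id refl) simp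
  then show ?thesis by blast
qed

lemma mother_group_subgroup:
  "subgroup (carrier (mother_group d m)) (BijGroup (ends m))"
  using mother_generators_Bij
  by (auto simp: mother_group_def BijGroup_def intro!: group.generate_is_subgroup[OF group_BijGroup, unfolded BijGroup_def])

lemma mother_group_finitary_iff:
  assumes "g \<in> carrier (mother_group d m)" "x \<in> ends m"
  shows "g x \<in> finitary_ends m \<longleftrightarrow> x \<in> finitary_ends m"
proof -
  have "g \<in> generate (BijGroup (ends m)) (mother_generators d m)"
    using assms(1) by (simp add: mother_group_def)
  then have "g \<in> Bij (ends m) \<and> (\<forall>x \<in> ends m. g x \<in> finitary_ends m \<longleftrightarrow> x \<in> finitary_ends m)"
  proof (induction rule: generate.induct)
    case one
    then show ?case using id_Bij[of "ends m"] by (simp add: BijGroup_def del: restrict_apply)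
      (simp add: restrict_def)
  next
    case (incl h)
    then show ?case using mother_generators_Bij mother_generators_finitary_iff by auto
  next
    case (inv h)
    have h: "h \<in> Bij (ends m)" using inv mother_generators_Bij by auto
    have "inv_into (ends m) h x \<in> ends m \<and> h (inv_into (ends m) h x) = x" if "x \<in> ends m" for x
      using h that by (auto simp: Bij_def bij_betw_def f_inv_into_f inv_into_into)
    then show ?case
      using h mother_generators_finitary_iff[OF inv] restrict_inv_into_Bij[OF h]
      unfolding inv_BijGroup[OF h] by (metis restrict_apply')
  next
    case (eng g h)
    have "g \<otimes>\<^bsub>BijGroup (ends m)\<^esub> h = compose (ends m) g h"
      using eng.IH by (simp add: BijGroup_def)
    moreover have "h x \<in> ends m" if "x \<in> ends m" for x
      using eng.IH that by (blast dest: Bij_imp_funcset)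
    moreover have "compose (ends m) g h \<in> Bij (ends m)"
      using eng.IH by (blast intro: compose_Bij)
    ultimately show ?case
      using eng.IH by (simp add: compose_eq)
  qed
  then show ?thesis using assms(2) by simp
qed

lemma mother_group_action:
  "group_action (mother_group d m) (finitary_ends m) (\<lambda>g. restrict g (finitary_ends m))"
proof -
  let ?E = "finitary_ends m" and ?G = "mother_group d m"
  have sub: "?E \<subseteq> ends m" by (auto simp: finitary_ends_def)
  have Bij: "g \<in> Bij (ends m)" if "g \<in> carrier ?G" for g
    using subgroup.subset[OF mother_group_subgroup] that by (auto simp: BijGroup_def)
  have mapsto: "g x \<in> ?E" if "g \<in> carrier ?G" "x \<in> ?E" for g x
    using mother_group_finitary_iff[OF that(1), of x] that(2) sub by auto
  have res: "restrict g ?E \<in> Bij ?E" if g: "g \<in> carrier ?G" for g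
  proof -
    have b: "bij_betw g (ends m) (ends m)" using Bij[OF g] by (simp add: Bij_def)
    have "g ` ?E = ?E"
    proof
      show "?E \<subseteq> g ` ?E"
      proof
        fix y assume y: "y \<in> ?E"
        then have "y \<in> g ` ends m"
          unfolding bij_betw_imp_surj_on[OF b] using sub by (rule subsetD[rotated])
        then obtain x where "x \<in> ends m" "g x = y" by (elim imageE) simp
        then show "y \<in> g ` ?E" using mother_group_finitary_iff[OF g, of x] y by blast
      qed
      show "g ` ?E \<subseteq> ?E"
        using mapsto[OF g] by blast
    qed
    moreover have "inj_on g ?E"
      using bij_betw_imp_inj_on[OF b] sub by (rule inj_on_subset)
    ultimately have "bij_betw g ?E ?E"
      by (simp add: bij_betw_def)
    then have "bij_betw (restrict g ?E) ?E ?E"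
      by (subst bij_betw_cong[where g = g]) simp_all
    then show ?thesis by (simp add: Bij_def)
  qed
  have "group ?G"
    using group.subgroup_imp_group[OF group_BijGroup mother_group_subgroup]
    by (simp add: mother_group_def)
  moreover have "(\<lambda>g. restrict g ?E) \<in> hom ?G (BijGroup ?E)"
  proof (rule homI)
    fix g h assume gh: "g \<in> carrier ?G" "h \<in> carrier ?G"
    have "g \<otimes>\<^bsub>?G\<^esub> h = compose (ends m) g h"
      using Bij[OF gh(1)] Bij[OF gh(2)] by (simp add: mother_group_def BijGroup_def)
    moreover have "restrict (compose (ends m) g h) ?E = compose ?E (restrict g ?E) (restrict h ?E)"
      using mapsto[OF gh(2)] sub by (auto simp: compose_def restrict_def fun_eq_iff)
    ultimately show "restrict (g \<otimes>\<^bsub>?G\<^esub> h) ?E = restrict g ?E \<otimes>\<^bsub>BijGroup ?E\<^esub> restrict h ?E"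
      using res[OF gh(1)] res[OF gh(2)] by (simp add: BijGroup_def)
  next
    show "restrict g ?E \<in> carrier (BijGroup ?E)" if "g \<in> carrier ?G" for g
      using res[OF that] by (simp add: BijGroup_def)
  qed
  ultimately show ?thesis
    unfolding group_action_def group_hom_def group_hom_axioms_def
    using group_BijGroup by auto
qed

end

end

theory Submission
  imports Defs
begin

text \<open>
  A graph with a reversible random walk is recurrent as soon as there are finitely supported functions
  that are bounded below at a given vertex and have arbitrarily small Dirichlet energy. This is the
  Dirichlet principle, proved here in \<open>recurrent_schreier_graphI\<close> for graphs of finitely many bijections
  by applying Green's identity to the probability of hitting the vertex within a given time. It remains
  to find such functions on the graph of the mother group.

  For binary digits and degree \<open>0\<close> the graph is a half-line traversed in the order of the reflected Gray
  code: the tile of level \<open>n + 1\<close> is the tile of level \<open>n\<close> followed by its mirror image. A higher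
  degree adds edges that change the digit \<open>n\<close> at other vertices; such an edge joins a vertex to its
  mirror image, and its length is comparable to the distance of the vertex from the mirror. In degree at most
  \<open>2\<close> the edge exists only at vertices with nonzero digits \<open>a < b < n - 1\<close> and \<open>n - 1\<close>, or with fewer
  nonzero digits, and the distance from the mirror is then at most of the order of \<open>2\<^sup>b\<close>. So the function
  \<^emph>\<open>position on the half-line\<close>, whose range on the tile of level \<open>n\<close> has length \<open>2\<^sup>n\<close>, gets from the edges
  at a mirror of level \<open>k\<close> an energy of order \<open>\<Sum>\<^sub>b b * 4\<^sup>b\<close> over \<open>b < k\<close>, which is of order \<open>k * 4\<^sup>k\<close>.
  There are \<open>2\<close> to the power \<open>n - k\<close> such mirrors in the tile, so the total is of order \<open>n * 4\<^sup>n\<close>, and the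
  effective conductance across the scale \<open>n\<close> is at most of the order of \<open>n\<close>. Letting the function drop by
  \<open>1 / n\<close> at scale \<open>n\<close> and normalising yields energy of order \<open>1 / (\<Sum>\<^sub>n 1 / n)\<close>, which tends to \<open>0\<close>. In
  degree \<open>3\<close> the same count gives \<open>n\<^sup>2\<close> in place of \<open>n\<close>, and the corresponding series converges.

  For general digits, a mirror is shared by \<open>m n\<close> copies of the tile, one of which leads to the
  origin. The position is replaced by the potential \<open>pot\<close>, whose slope in each of the \<open>m n - 1\<close> outer
  copies is smaller by the factor \<open>1 / (m n - 1)\<close>; this is how a unit current would divide. The lengths
  \<open>len n\<close> then grow by the factor \<open>m n / (m n - 1)\<close>, still geometrically because the degrees are bounded,
  and the energy of all the copies together grows by the same factor rather than by its square. The
  estimate on the energy is \<open>energy_pot\<close>, resting on \<open>sparse_sum_pot\<close>, and \<open>low_energy_function\<close> combines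
  the scales.
\<close>

section \<open>A recurrence criterion for Schreier graphs\<close>

text \<open>
  The generators act on the finitary ends by bijections, so simple random walk on a Schreier graph
  crosses each generator forwards or backwards with the same probability. The walk is therefore
  symmetric, all vertices have the same degree, and sums over vertices may be shifted along a
  generator. This is all that the criterion uses.
\<close>

locale permutation_action =
  fixes S :: "'g set" and \<phi> :: "'g \<Rightarrow> 'a \<Rightarrow> 'a" and A :: "'a set"
  assumes finite_S: "finite S" and S_nonempty: "S \<noteq> {}"
    and bij: "s \<in> S \<Longrightarrow> bij_betw (\<phi> s) A A"
begin

abbreviation pre :: "'g \<Rightarrow> 'a \<Rightarrow> 'a" where
  "pre s \<equiv> inv_into A (\<phi> s)"

lemma closed [simp]: "s \<in> S \<Longrightarrow> x \<in> A \<Longrightarrow> \<phi> s x \<in> A"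
  using bij bij_betwE by blast

lemma pre_closed [simp]: "s \<in> S \<Longrightarrow> x \<in> A \<Longrightarrow> pre s x \<in> A"
  by (metis bij bij_betw_imp_surj_on inv_into_into)

lemma pre_left [simp]: "s \<in> S \<Longrightarrow> x \<in> A \<Longrightarrow> pre s (\<phi> s x) = x"
  by (meson bij bij_betw_inv_into_left)

lemma pre_right [simp]: "s \<in> S \<Longrightarrow> x \<in> A \<Longrightarrow> \<phi> s (pre s x) = x"
  by (meson bij bij_betw_inv_into_right)

lemma card_S_pos [simp]: "0 < card S"
  using finite_S S_nonempty by (simp add: card_gt_0_iff)

definition avg :: "('a \<Rightarrow> real) \<Rightarrow> 'a \<Rightarrow> real" where
  "avg f x = (\<Sum>s\<in>S. f (\<phi> s x) + f (pre s x)) / (2 * real (card S))"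

lemma avg_mono:
  assumes "x \<in> A" "\<And>y. y \<in> A \<Longrightarrow> f y \<le> g y"
  shows "avg f x \<le> avg g x"
  unfolding avg_def using assms by (intro divide_right_mono sum_mono add_mono) auto

lemma avg_const [simp]: "avg (\<lambda>_. c) x = c"
  using card_S_pos by (simp add: avg_def)

text \<open>
  At every vertex there is one outgoing and one incoming arc per generator, the latter because each
  generator is a bijection; hence one step of the walk is the operator \<^const>\<open>avg\<close>.
\<close>

lemma
  assumes "x \<in> A"
  shows finite_set_srw_step: "finite (set_pmf (srw_step (schreier_graph S \<phi> A) x))"
    and set_srw_step: "set_pmf (srw_step (schreier_graph S \<phi> A) x) \<subseteq> A"
    and integral_srw_step:
      "(\<integral>y. f y \<partial>measure_pmf (srw_step (schreier_graph S \<phi> A) x)) = avg f x"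
proof -
  let ?G = "schreier_graph S \<phi> A"
  let ?in = "(\<lambda>s. (pre s x, s)) ` S"
  have out_eq: "out_arcs ?G x = (\<lambda>s. (x, s)) ` S"
    using assms by (auto simp: out_arcs_def schreier_graph_def)
  have in_eq: "in_arcs ?G x = ?in"
  proof -
    have "(y, s) \<in> ?in" if "s \<in> S" "y \<in> A" "\<phi> s y = x" for y s
      using that by (intro image_eqI[of _ _ s]) auto
    then show ?thesis
      using assms by (auto simp: in_arcs_def schreier_graph_def)
  qed
  have fin: "finite (out_arcs ?G x <+> in_arcs ?G x)"
    unfolding out_eq in_eq using finite_S by simp
  have ne: "out_arcs ?G x <+> in_arcs ?G x \<noteq> {}"
    unfolding out_eq using S_nonempty by auto
  have set_eq: "set_pmf (srw_step ?G x)
      = case_sum (head ?G) (tail ?G) ` (out_arcs ?G x <+> in_arcs ?G x)"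
    unfolding srw_step_def using fin ne by simp
  show "finite (set_pmf (srw_step ?G x))"
    unfolding set_eq using fin by simp
  show "set_pmf (srw_step ?G x) \<subseteq> A"
    unfolding set_eq out_eq in_eq using assms by (auto simp: schreier_graph_def)
  have inj_out: "inj_on (\<lambda>s. (x, s)) S" and inj_in: "inj_on (\<lambda>s. (pre s x, s)) S"
    by (auto intro: inj_onI)
  have "(\<integral>y. f y \<partial>measure_pmf (srw_step ?G x))
      = (\<Sum>e\<in>out_arcs ?G x <+> in_arcs ?G x. f (case_sum (head ?G) (tail ?G) e))
        / real (card (out_arcs ?G x <+> in_arcs ?G x))"
    unfolding srw_step_def using fin ne by (simp add: integral_pmf_of_set)
  also have "\<dots> = avg f x"
    unfolding out_eq in_eq avg_def using finite_S
    by (simp add: sum.Plus card_Plus card_image inj_out inj_in sum.reindex sum.distrib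
        schreier_graph_def)
  finally show "(\<integral>y. f y \<partial>measure_pmf (srw_step ?G x)) = avg f x" .
qed

text \<open>
  The probability that the walk from \<open>x\<close> visits \<open>v\<close> within the first \<open>n\<close> steps, time \<open>0\<close> included.
  Truncating in time keeps the function finitely supported, so that Green's identity below is one
  between finite sums.
\<close>

primrec hit :: "'a \<Rightarrow> nat \<Rightarrow> 'a \<Rightarrow> real" where
  "hit v 0 = (\<lambda>x. if x = v then 1 else 0)"
| "hit v (Suc n) = (\<lambda>x. if x = v then 1 else avg (hit v n) x)"

lemma hit_self [simp]: "hit v n v = 1"
  by (cases n) auto

lemma hit_bounds: "x \<in> A \<Longrightarrow> 0 \<le> hit v n x \<and> hit v n x \<le> 1"
proof (induction n arbitrary: x)
  case (Suc n)
  have "avg (\<lambda>_. 0) x \<le> avg (hit v n) x" "avg (hit v n) x \<le> avg (\<lambda>_. 1) x"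
    using Suc by (intro avg_mono; simp)+
  then show ?case by simp
qed auto

lemma avg_hit_bounds: "x \<in> A \<Longrightarrow> 0 \<le> avg (hit v n) x \<and> avg (hit v n) x \<le> 1"
  using avg_mono[of x "\<lambda>_. 0" "hit v n"] avg_mono[of x "hit v n" "\<lambda>_. 1"] hit_bounds
  by simp

lemma hit_mono: "x \<in> A \<Longrightarrow> hit v n x \<le> hit v (Suc n) x"
proof (induction n arbitrary: x)
  case 0
  then show ?case using avg_hit_bounds[of x v 0] by simp
next
  case (Suc n)
  have "avg (hit v n) x \<le> avg (hit v (Suc n)) x"
    using Suc by (intro avg_mono) auto
  then show ?case by simp
qed

lemma finite_hit_support: "finite {x \<in> A. hit v n x \<noteq> 0}"
proof (induction n)
  case (Suc n)
  let ?F = "{x \<in> A. hit v n x \<noteq> 0}"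
  have "{x \<in> A. hit v (Suc n) x \<noteq> 0} \<subseteq> insert v (\<Union>s\<in>S. pre s ` ?F \<union> \<phi> s ` ?F)"
  proof
    fix x assume x: "x \<in> {x \<in> A. hit v (Suc n) x \<noteq> 0}"
    show "x \<in> insert v (\<Union>s\<in>S. pre s ` ?F \<union> \<phi> s ` ?F)"
    proof (cases "x = v")
      case False
      then have "(\<Sum>s\<in>S. hit v n (\<phi> s x) + hit v n (pre s x)) \<noteq> 0"
        using x by (auto simp: avg_def)
      then obtain s where s: "s \<in> S" "hit v n (\<phi> s x) + hit v n (pre s x) \<noteq> 0"
        by (meson sum.not_neutral_contains_not_neutral)
      then consider "hit v n (\<phi> s x) \<noteq> 0" | "hit v n (pre s x) \<noteq> 0" by force
      then have "x \<in> pre s ` ?F \<union> \<phi> s ` ?F"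
      proof cases
        case 1
        then have "x \<in> pre s ` ?F"
          using s x by (intro image_eqI[of _ _ "\<phi> s x"]) auto
        then show ?thesis ..
      next
        case 2
        then have "x \<in> \<phi> s ` ?F"
          using s x by (intro image_eqI[of _ _ "pre s x"]) auto
        then show ?thesis ..
      qed
      then show ?thesis using s by blast
    qed simp
  qed
  moreover have "finite (insert v (\<Union>s\<in>S. pre s ` ?F \<union> \<phi> s ` ?F))"
    using Suc finite_S by simp
  ultimately show ?case by (rule finite_subset)
qed auto

text \<open>
  Invariance of summation under a generator; the set \<open>B\<close> only has to contain the support of the
  summand and its preimage.
\<close>

lemma sum_shift:
  fixes F :: "'a \<Rightarrow> real"
  assumes "s \<in> S" "finite B" "B \<subseteq> A"
    and "\<And>x. x \<in> A \<Longrightarrow> F x \<noteq> 0 \<Longrightarrow> x \<in> B \<and> pre s x \<in> B"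
  shows "(\<Sum>x\<in>B. F (\<phi> s x)) = (\<Sum>x\<in>B. F x)"
proof -
  have "inj_on (\<phi> s) B"
    using bij[OF assms(1)] assms(3) by (meson bij_betw_def inj_on_subset)
  then have "(\<Sum>x\<in>B. F (\<phi> s x)) = (\<Sum>y\<in>\<phi> s ` B. F y)"
    by (simp add: sum.reindex)
  also have "\<dots> = (\<Sum>y\<in>\<phi> s ` B \<inter> B. F y)"
  proof (intro sum.mono_neutral_right ballI)
    fix y assume "y \<in> \<phi> s ` B - \<phi> s ` B \<inter> B"
    then have "y \<in> A" "y \<notin> B" using assms by auto
    then show "F y = 0" using assms(4) by blast
  qed (use assms in auto)
  also have "\<dots> = (\<Sum>y\<in>B. F y)"
  proof (intro sum.mono_neutral_left ballI)
    fix y assume y: "y \<in> B - \<phi> s ` B \<inter> B"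
    show "F y = 0"
    proof (rule ccontr)
      assume "F y \<noteq> 0"
      then have "pre s y \<in> B" using assms(4) y assms(3) by blast
      then have "\<phi> s (pre s y) \<in> \<phi> s ` B" by blast
      then show False using y assms by auto
    qed
  qed (use assms in auto)
  finally show ?thesis .
qed

text \<open>
  Summation by parts: the product of the values at the heads of the arcs is shifted back to their tails,
  and the two mixed products become the forward and the backward half of \<^const>\<open>avg\<close>.
\<close>

lemma green:
  assumes "finite B" "B \<subseteq> A"
    and f: "\<And>x. x \<in> A \<Longrightarrow> f x \<noteq> 0 \<Longrightarrow> x \<in> B"
    and u: "\<And>x. x \<in> A \<Longrightarrow> u x \<noteq> 0 \<Longrightarrow> x \<in> B"
    and f_pre: "\<And>s x. s \<in> S \<Longrightarrow> x \<in> A \<Longrightarrow> f x \<noteq> 0 \<Longrightarrow> pre s x \<in> B"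
  shows "(\<Sum>x\<in>B. f x * (u x - avg u x)) =
    (\<Sum>x\<in>B. \<Sum>s\<in>S. (f x - f (\<phi> s x)) * (u x - u (\<phi> s x))) / (2 * real (card S))"
proof -
  have *: "(\<Sum>x\<in>B. (f x - f (\<phi> s x)) * (u x - u (\<phi> s x)))
      = (\<Sum>x\<in>B. f x * (2 * u x - u (\<phi> s x) - u (pre s x)))" if s: "s \<in> S" for s
  proof -
    have "(\<Sum>x\<in>B. f (\<phi> s x) * u (\<phi> s x)) = (\<Sum>x\<in>B. f x * u x)"
      using assms s by (intro sum_shift) auto
    moreover have "(\<Sum>x\<in>B. f (\<phi> s x) * u (pre s (\<phi> s x))) = (\<Sum>x\<in>B. f x * u (pre s x))"
      using assms s by (intro sum_shift[of s B "\<lambda>x. f x * u (pre s x)"]) auto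
    moreover have "(\<Sum>x\<in>B. f (\<phi> s x) * u (pre s (\<phi> s x))) = (\<Sum>x\<in>B. f (\<phi> s x) * u x)"
      using assms(2) s by (intro sum.cong) auto
    moreover have "(\<Sum>x\<in>B. (f x - f (\<phi> s x)) * (u x - u (\<phi> s x))) =
        (\<Sum>x\<in>B. f x * u x) - (\<Sum>x\<in>B. f x * u (\<phi> s x)) - (\<Sum>x\<in>B. f (\<phi> s x) * u x)
          + (\<Sum>x\<in>B. f (\<phi> s x) * u (\<phi> s x))"
      unfolding sum_subtractf[symmetric] sum.distrib[symmetric]
      by (intro sum.cong refl) (simp add: algebra_simps)
    moreover have "(\<Sum>x\<in>B. f x * (2 * u x - u (\<phi> s x) - u (pre s x))) =
        (\<Sum>x\<in>B. f x * u x) - (\<Sum>x\<in>B. f x * u (\<phi> s x)) - (\<Sum>x\<in>B. f x * u (pre s x))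
          + (\<Sum>x\<in>B. f x * u x)"
      unfolding sum_subtractf[symmetric] sum.distrib[symmetric]
      by (intro sum.cong refl) (simp add: algebra_simps)
    ultimately show ?thesis by linarith
  qed
  have "(\<Sum>x\<in>B. \<Sum>s\<in>S. (f x - f (\<phi> s x)) * (u x - u (\<phi> s x)))
      = (\<Sum>s\<in>S. \<Sum>x\<in>B. (f x - f (\<phi> s x)) * (u x - u (\<phi> s x)))"
    by (rule sum.swap)
  also have "\<dots> = (\<Sum>s\<in>S. \<Sum>x\<in>B. f x * (2 * u x - u (\<phi> s x) - u (pre s x)))"
    using * by simp
  also have "\<dots> = (\<Sum>x\<in>B. \<Sum>s\<in>S. f x * (2 * u x - u (\<phi> s x) - u (pre s x)))"
    by (rule sum.swap)
  also have "\<dots> = (\<Sum>x\<in>B. f x * (u x - avg u x) * (2 * real (card S)))"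
  proof (rule sum.cong)
    fix x
    have "(\<Sum>s\<in>S. 2 * u x - u (\<phi> s x) - u (pre s x)) = (u x - avg u x) * (2 * real (card S))"
      using card_S_pos by (simp add: avg_def sum_subtractf sum.distrib left_diff_distrib)
    then show "(\<Sum>s\<in>S. f x * (2 * u x - u (\<phi> s x) - u (pre s x)))
        = f x * (u x - avg u x) * (2 * real (card S))"
      by (simp add: sum_distrib_left[symmetric])
  qed simp
  finally show ?thesis
    using card_S_pos by (simp add: sum_distrib_right[symmetric])
qed

text \<open>
  The Dirichlet principle. Up to the time truncation, \<^term>\<open>hit v n\<close> is harmonic away from \<open>v\<close>, so
  pairing it with \<open>f\<close> in Green's identity leaves \<open>f v\<close> times the escape probability, and pairing it with
  itself shows that its own energy is at most the escape probability, hence at most \<open>1\<close>. The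
  Cauchy-Schwarz inequality bounds the former by the energy of \<open>f\<close>. The sum on the right is the defect
  from harmonicity, which vanishes as \<open>n\<close> grows.
\<close>

lemma escape_bound:
  assumes v: "v \<in> A" and F: "finite {x \<in> A. f x \<noteq> 0}"
    and e: "\<And>B. finite B \<Longrightarrow> B \<subseteq> A \<Longrightarrow> (\<Sum>x\<in>B. \<Sum>s\<in>S. (f x - f (\<phi> s x))\<^sup>2) \<le> e"
  shows "f v * (1 - avg (hit v n) v) \<le>
    sqrt e + (\<Sum>x\<in>{x \<in> A. f x \<noteq> 0}. \<bar>f x\<bar> * (hit v (Suc n) x - hit v n x))"
proof -
  let ?h = "hit v n" and ?N = "2 * real (card S)" and ?F = "{x \<in> A. f x \<noteq> 0}"
  let ?H = "{x \<in> A. hit v n x \<noteq> 0}"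
  define B where "B = ?F \<union> ?H \<union> (\<Union>s\<in>S. pre s ` (?F \<union> ?H)) \<union> {v}"
  have B: "finite B" "B \<subseteq> A"
    using F finite_hit_support finite_S v by (auto simp: B_def)
  have N: "1 \<le> ?N" using card_S_pos by linarith
  let ?D = "\<lambda>f u. \<Sum>x\<in>B. \<Sum>s\<in>S. (f x - f (\<phi> s x)) * (u x - u (\<phi> s x))"
  have off: "?h x - avg ?h x = - (hit v (Suc n) x - ?h x)" if "x \<noteq> v" for x
    using that by simp
  have split: "(\<Sum>x\<in>B. g x * (?h x - avg ?h x)) =
      g v * (1 - avg ?h v) - (\<Sum>x\<in>B - {v}. g x * (hit v (Suc n) x - ?h x))" for g
  proof -
    have "(\<Sum>x\<in>B. g x * (?h x - avg ?h x)) =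
        g v * (?h v - avg ?h v) + (\<Sum>x\<in>B - {v}. g x * (?h x - avg ?h x))"
      using B by (intro sum.remove) (auto simp: B_def)
    also have "(\<Sum>x\<in>B - {v}. g x * (?h x - avg ?h x)) =
        (\<Sum>x\<in>B - {v}. - (g x * (hit v (Suc n) x - ?h x)))"
      by (intro sum.cong refl) (auto simp: algebra_simps)
    finally show ?thesis by (simp add: sum_negf)
  qed
  have green_f: "(\<Sum>x\<in>B. f x * (?h x - avg ?h x)) = ?D f ?h / ?N"
    by (rule green) (use B in \<open>auto simp: B_def\<close>)
  have green_h: "(\<Sum>x\<in>B. ?h x * (?h x - avg ?h x)) = ?D ?h ?h / ?N"
    by (rule green) (use B in \<open>auto simp: B_def\<close>)
  \<comment> \<open>The truncated hitting probabilities increase with \<open>n\<close>, so they are subharmonic away from \<open>v\<close> and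
    the defect only lowers their energy.\<close>
  have "0 \<le> (\<Sum>x\<in>B - {v}. ?h x * (hit v (Suc n) x - ?h x))"
    using B hit_mono hit_bounds by (intro sum_nonneg mult_nonneg_nonneg) (auto simp del: hit.simps)
  then have "?D ?h ?h / ?N \<le> 1 - avg ?h v"
    using split[of ?h] green_h by (simp del: hit.simps)
  also have "\<dots> \<le> 1" using avg_hit_bounds v by simp
  finally have Dh: "?D ?h ?h \<le> ?N" using N by (simp add: pos_divide_le_eq)
  have Df: "?D f f \<le> e" using e[OF B] by (simp add: power2_eq_square)
  have e0: "0 \<le> e" using e[of "{}"] by simp
  have "(?D f ?h)\<^sup>2 \<le> ?D f f * ?D ?h ?h"
    using Cauchy_Schwarz_ineq_sum[of "\<lambda>(x, s). f x - f (\<phi> s x)" "\<lambda>(x, s). ?h x - ?h (\<phi> s x)" "B \<times> S"]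
    by (simp add: sum.cartesian_product split_def power2_eq_square)
  also have "\<dots> \<le> e * ?N"
    using Df Dh e0 by (intro mult_mono) (auto intro!: sum_nonneg)
  also have "\<dots> \<le> e * ?N\<^sup>2"
    using e0 N by (intro mult_left_mono) (auto simp: power2_eq_square)
  finally have "?D f ?h \<le> sqrt (e * ?N\<^sup>2)"
    by (rule real_le_rsqrt)
  then have "?D f ?h / ?N \<le> sqrt e"
    using N by (simp add: real_sqrt_mult pos_divide_le_eq)
  moreover have "(\<Sum>x\<in>B - {v}. f x * (hit v (Suc n) x - ?h x)) \<le>
      (\<Sum>x\<in>?F. \<bar>f x\<bar> * (hit v (Suc n) x - ?h x))"
  proof -
    have "(\<Sum>x\<in>B - {v}. f x * (hit v (Suc n) x - ?h x)) \<le>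
        (\<Sum>x\<in>B. \<bar>f x\<bar> * (hit v (Suc n) x - ?h x))"
      using B hit_mono by (intro order.trans[OF sum_mono sum_mono2])
        (auto simp del: hit.simps intro!: mult_right_mono mult_nonneg_nonneg)
    also have "\<dots> = (\<Sum>x\<in>?F. \<bar>f x\<bar> * (hit v (Suc n) x - ?h x))"
      using B by (intro sum.mono_neutral_right) (auto simp: B_def)
    finally show ?thesis .
  qed
  ultimately show ?thesis using split[of f] green_f by linarith
qed

lemma avg_hit_tendsto:
  assumes v: "v \<in> A"
    and ex: "\<And>e. e > 0 \<Longrightarrow> \<exists>f :: 'a \<Rightarrow> real. finite {x \<in> A. f x \<noteq> 0} \<and> 1 / 2 \<le> f v \<and>
      (\<forall>B. finite B \<longrightarrow> B \<subseteq> A \<longrightarrow> (\<Sum>x\<in>B. \<Sum>s\<in>S. (f x - f (\<phi> s x))\<^sup>2) \<le> e)"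
  shows "(\<lambda>n. avg (hit v n) v) \<longlonglongrightarrow> 1"
proof -
  have "(\<lambda>n. 1 - avg (hit v n) v) \<longlonglongrightarrow> 0"
  proof (rule LIMSEQ_I)
    fix r :: real assume r: "0 < r"
    have "0 < (r / 4)\<^sup>2" using r by simp
    from ex[OF this] obtain f :: "'a \<Rightarrow> real" where f:
      "finite {x \<in> A. f x \<noteq> 0}" "1 / 2 \<le> f v"
      "\<And>B. finite B \<Longrightarrow> B \<subseteq> A \<Longrightarrow> (\<Sum>x\<in>B. \<Sum>s\<in>S. (f x - f (\<phi> s x))\<^sup>2) \<le> (r / 4)\<^sup>2"
      by blast
    let ?d = "\<lambda>n. \<Sum>x\<in>{x \<in> A. f x \<noteq> 0}. \<bar>f x\<bar> * (hit v (Suc n) x - hit v n x)"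
    have "?d \<longlonglongrightarrow> (\<Sum>x\<in>{x \<in> A. f x \<noteq> 0}. \<bar>f x\<bar> * 0)"
    proof (intro tendsto_sum tendsto_mult tendsto_const)
      fix x assume x: "x \<in> {x \<in> A. f x \<noteq> 0}"
      \<comment> \<open>Bounded monotone sequences have vanishing increments, at each of the finitely many points where
        \<open>f\<close> is nonzero.\<close>
      have "incseq (\<lambda>n. hit v n x)"
        using hit_mono x by (intro incseq_SucI) blast
      moreover have "\<forall>n. hit v n x \<le> 1"
        using hit_bounds x by blast
      ultimately obtain l where l: "(\<lambda>n. hit v n x) \<longlonglongrightarrow> l"
        by (rule incseq_convergent)
      have "(\<lambda>n. hit v (Suc n) x - hit v n x) \<longlonglongrightarrow> l - l"
        by (intro tendsto_diff l LIMSEQ_Suc)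
      then show "(\<lambda>n. hit v (Suc n) x - hit v n x) \<longlonglongrightarrow> 0" by simp
    qed
    then have "?d \<longlonglongrightarrow> 0" by simp
    then have "eventually (\<lambda>n. ?d n < r / 4) sequentially"
      using r by (intro order_tendstoD) auto
    then obtain n0 where n0: "\<And>n. n \<ge> n0 \<Longrightarrow> ?d n < r / 4"
      by (auto simp: eventually_sequentially)
    have "norm (1 - avg (hit v n) v - 0) < r" if n: "n \<ge> n0" for n
    proof -
      have "1 / 2 * (1 - avg (hit v n) v) \<le> f v * (1 - avg (hit v n) v)"
        using f(2) avg_hit_bounds[OF v] by (intro mult_right_mono) auto
      also have "\<dots> \<le> sqrt ((r / 4)\<^sup>2) + ?d n"
        by (rule escape_bound[OF v f(1) f(3)])
      also have "\<dots> < r / 4 + r / 4"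
        using n0[OF n] r by simp
      finally show ?thesis using avg_hit_bounds[OF v, of v n] by simp
    qed
    then show "\<exists>n0. \<forall>n\<ge>n0. norm (1 - avg (hit v n) v - 0) < r" by blast
  qed
  from tendsto_diff[OF tendsto_const[of 1] this] show ?thesis by simp
qed

text \<open>
  The link between the trajectory measure and \<^const>\<open>hit\<close>: having followed a given path up to time
  \<open>k\<close>, the walk visits \<open>v\<close> later at least with the probability predicted by the recursion. Induction on
  \<open>n\<close> splits the event according to the position at time \<open>k + 1\<close>, which has finitely many possible
  values; an inequality suffices for recurrence.
\<close>

lemma cylinder_hit_lower_bound:
  fixes start :: 'a
  assumes "xs k \<in> A"
  defines "G \<equiv> schreier_graph S \<phi> A"
  shows "ennreal (indicator {start} (xs 0) * (\<Prod>i<k. pmf (srw_step G (xs i)) (xs (Suc i))) * avg (hit v n) (xs k))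
    \<le> emeasure (srw_measure G start) {\<omega>. (\<forall>i\<le>k. \<omega> i = xs i) \<and> (\<exists>j>k. \<omega> j = v)}"
  using assms(1)
proof (induction n arbitrary: k xs)
  let ?M = "srw_measure G start"
  let ?w = "\<lambda>k xs. indicator {start} (xs 0) * (\<Prod>i<k. pmf (srw_step G (xs i)) (xs (Suc i))) :: real"
  let ?E = "\<lambda>k xs. {\<omega>. (\<forall>i\<le>k. \<omega> i = xs i) \<and> (\<exists>j>k. \<omega> j = v)}"
  have [measurable_cong]: "sets ?M = sets (PiM UNIV (\<lambda>_. count_space UNIV))"
    by (rule sets_srw_measure)
  have space: "space ?M = UNIV"
    using sets_eq_imp_space_eq[OF sets_srw_measure[of G start]] by (simp add: space_PiM)
  have comp: "(\<lambda>\<omega>. \<omega> i) \<in> ?M \<rightarrow>\<^sub>M count_space UNIV" for i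
    by measurable
  have atom: "{\<omega>. \<omega> i = y} \<in> sets ?M" for i y
    using measurable_sets[OF comp, of "{y}" i] by (simp add: space vimage_def)
  have cyl: "{\<omega>. \<forall>i\<le>k. \<omega> i = xs i} \<in> sets ?M" for k xs
  proof -
    have "{\<omega>. \<forall>i\<le>k. \<omega> i = xs i} = (\<Inter>i\<in>{..k}. {\<omega>. \<omega> i = xs i})" by auto
    then show ?thesis by (auto intro!: sets.finite_INT atom)
  qed
  have ev: "?E k xs \<in> sets ?M" for k xs
  proof -
    have "?E k xs = {\<omega>. \<forall>i\<le>k. \<omega> i = xs i} \<inter> (\<Union>j\<in>{k<..}. {\<omega>. \<omega> j = v})" by auto
    then show ?thesis by (auto intro!: sets.Int cyl sets.countable_UN' atom)
  qed
  have w_nonneg: "0 \<le> ?w k xs" for k xs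
    by (intro mult_nonneg_nonneg prod_nonneg) auto
  have step: "ennreal (?w k xs * avg h (xs k)) \<le> emeasure ?M (?E k xs)"
    if xs: "xs k \<in> A" and h: "\<And>y. y \<in> A \<Longrightarrow> 0 \<le> h y"
      and le: "\<And>y. y \<in> A \<Longrightarrow> ennreal (?w (Suc k) (xs(Suc k := y)) * h y)
        \<le> emeasure ?M (?E k xs \<inter> {\<omega>. \<omega> (Suc k) = y})"
    for k xs h
  proof -
    let ?Y = "set_pmf (srw_step G (xs k))"
    have Y: "finite ?Y" "?Y \<subseteq> A"
      unfolding G_def using xs by (auto simp: finite_set_srw_step dest: set_srw_step)
    have w: "?w (Suc k) (xs(Suc k := y)) = ?w k xs * pmf (srw_step G (xs k)) y" for y
    proof -
      have "(\<Prod>i<k. pmf (srw_step G ((xs(Suc k := y)) i)) ((xs(Suc k := y)) (Suc i)))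
          = (\<Prod>i<k. pmf (srw_step G (xs i)) (xs (Suc i)))"
        by (intro prod.cong) auto
      then show ?thesis by simp
    qed
    have "avg h (xs k) = (\<Sum>y\<in>?Y. pmf (srw_step G (xs k)) y * h y)"
      unfolding integral_srw_step[OF xs, symmetric] G_def[symmetric] using Y
      by (subst integral_measure_pmf[of ?Y]) (auto simp: mult.commute)
    then have "ennreal (?w k xs * avg h (xs k))
        = ennreal (\<Sum>y\<in>?Y. ?w (Suc k) (xs(Suc k := y)) * h y)"
      by (simp only: w sum_distrib_left mult.assoc)
    also have "\<dots> = (\<Sum>y\<in>?Y. ennreal (?w (Suc k) (xs(Suc k := y)) * h y))"
      using Y h by (intro sum_ennreal[symmetric] mult_nonneg_nonneg w_nonneg) auto
    also have "\<dots> \<le> (\<Sum>y\<in>?Y. emeasure ?M (?E k xs \<inter> {\<omega>. \<omega> (Suc k) = y}))"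
      using Y le by (intro sum_mono) auto
    also have "\<dots> = emeasure ?M (\<Union>y\<in>?Y. ?E k xs \<inter> {\<omega>. \<omega> (Suc k) = y})"
      using Y by (intro sum_emeasure) (auto simp: disjoint_family_on_def intro!: sets.Int ev atom)
    also have "\<dots> \<le> emeasure ?M (?E k xs)"
      by (intro emeasure_mono ev) auto
    finally show ?thesis .
  qed
  have at_v: "ennreal (?w (Suc j) (ys(Suc j := v)))
      \<le> emeasure ?M (?E j ys \<inter> {\<omega>. \<omega> (Suc j) = v})" for j ys
  proof -
    have "ennreal (?w (Suc j) (ys(Suc j := v))) = emeasure ?M {\<omega>. \<forall>i\<le>Suc j. \<omega> i = (ys(Suc j := v)) i}"
      by (rule srw_measure_cylinder[symmetric])
    also have "\<dots> \<le> emeasure ?M (?E j ys \<inter> {\<omega>. \<omega> (Suc j) = v})"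
      by (intro emeasure_mono sets.Int ev atom) (auto simp: le_Suc_eq)
    finally show ?thesis .
  qed
  {
    case 0
    then show ?case
    proof (rule step)
      fix y
      show "ennreal (?w (Suc k) (xs(Suc k := y)) * hit v 0 y)
        \<le> emeasure ?M (?E k xs \<inter> {\<omega>. \<omega> (Suc k) = y})"
        using at_v[of xs k] by (cases "y = v") auto
    qed auto
  next
    case (Suc n)
    show ?case
    proof (rule step)
      fix y assume y: "y \<in> A"
      show "ennreal (?w (Suc k) (xs(Suc k := y)) * hit v (Suc n) y)
        \<le> emeasure ?M (?E k xs \<inter> {\<omega>. \<omega> (Suc k) = y})"
      proof (cases "y = v")
        case True
        then show ?thesis using at_v[of xs k] by simp
      next
        case False
        have "ennreal (?w (Suc k) (xs(Suc k := y)) * hit v (Suc n) y)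
            \<le> emeasure ?M (?E (Suc k) (xs(Suc k := y)))"
          using Suc.IH[of "xs(Suc k := y)" "Suc k"] y False by simp
        also have "\<dots> \<le> emeasure ?M (?E k xs \<inter> {\<omega>. \<omega> (Suc k) = y})"
          by (intro emeasure_mono sets.Int ev atom) (auto simp: le_Suc_eq, metis Suc_lessD)
        finally show ?thesis .
      qed
    qed (use Suc.prems hit_bounds in \<open>auto simp del: hit.simps\<close>)
  }
qed

text \<open>
  Recurrence criterion: for every vertex \<open>v\<close> there are finitely supported functions that are bounded
  below at \<open>v\<close> and have arbitrarily small energy.
\<close>

theorem recurrent_schreier_graphI:
  assumes ex: "\<And>v e. v \<in> A \<Longrightarrow> e > 0 \<Longrightarrow> \<exists>f :: 'a \<Rightarrow> real. finite {x \<in> A. f x \<noteq> 0} \<and> 1 / 2 \<le> f v \<and>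
      (\<forall>B. finite B \<longrightarrow> B \<subseteq> A \<longrightarrow> (\<Sum>x\<in>B. \<Sum>s\<in>S. (f x - f (\<phi> s x))\<^sup>2) \<le> e)"
  shows "recurrent_graph (schreier_graph S \<phi> A)"
  unfolding recurrent_graph_def
proof
  let ?G = "schreier_graph S \<phi> A"
  fix v assume "v \<in> verts ?G"
  then have v: "v \<in> A" by (simp add: schreier_graph_def)
  interpret M: prob_space "srw_measure ?G v"
    by (rule prob_space_srw_measure)
  let ?E = "{\<omega>. \<exists>n>0. \<omega> n = v}"
  have space: "space (srw_measure ?G v) = UNIV"
    using sets_eq_imp_space_eq[OF sets_srw_measure[of ?G v]] by (simp add: space_PiM)
  have E: "?E \<in> sets (srw_measure ?G v)"
  proof -
    have "(\<lambda>\<omega>. \<omega> i) \<in> srw_measure ?G v \<rightarrow>\<^sub>M count_space UNIV" for i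
      unfolding measurable_cong_sets[OF sets_srw_measure refl] by measurable
    from measurable_sets[OF this, of "{v}"] have "{\<omega>. \<omega> i = v} \<in> sets (srw_measure ?G v)" for i
      by (simp add: space vimage_def)
    then have "(\<Union>i\<in>{0<..}. {\<omega>. \<omega> i = v}) \<in> sets (srw_measure ?G v)"
      by (intro sets.countable_UN') auto
    also have "(\<Union>i\<in>{0<..}. {\<omega>. \<omega> i = v}) = ?E" by auto
    finally show ?thesis .
  qed
  have "avg (hit v n) v \<le> M.prob ?E" for n
  proof -
    have "ennreal (avg (hit v n) v) \<le> emeasure (srw_measure ?G v)
        {\<omega>. (\<forall>i\<le>0. \<omega> i = v) \<and> (\<exists>j>0. \<omega> j = v)}"
      using cylinder_hit_lower_bound[where xs = "\<lambda>_. v" and k = 0 and v = v and start = v and n = n] v by simp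
    also have "\<dots> \<le> emeasure (srw_measure ?G v) ?E"
      using E by (intro emeasure_mono) auto
    finally show ?thesis by (simp add: M.emeasure_eq_measure)
  qed
  moreover have "(\<lambda>n. avg (hit v n) v) \<longlonglongrightarrow> 1"
    using v ex by (intro avg_hit_tendsto) auto
  ultimately have "1 \<le> M.prob ?E"
    by (intro LIMSEQ_le_const2) auto
  then have "M.prob ?E = 1"
    using M.prob_le_1[of ?E] by linarith
  then have "AE \<omega> in srw_measure ?G v. \<omega> \<in> ?E"
    by (rule M.AE_prob_1)
  then show "AE \<omega> in srw_measure ?G v. \<exists>n>0. \<omega> n = v" by simp
qed

end

section \<open>Tiles\<close>

text \<open>
  The finite tile of level \<open>n\<close> consists of the ends whose digits from \<open>n\<close> on vanish. The tile of level
  \<open>n + 1\<close> is the union of \<open>m n\<close> copies of it, indexed by the digit \<open>n\<close>, and every sum and every function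
  below is built along this decomposition.
\<close>

locale spherical_tree =
  fixes m :: "nat \<Rightarrow> nat" and M :: nat
  assumes degree_ge: "2 \<le> m i" and degree_le: "m i \<le> M"
begin

definition tile :: "nat \<Rightarrow> (nat \<Rightarrow> nat) set" where
  "tile n = {x \<in> ends m. \<forall>i\<ge>n. x i = 0}"

lemma tile_0: "tile 0 = {\<lambda>_. 0}"
proof -
  have "0 < m i" for i using degree_ge[of i] by simp
  then show ?thesis by (auto simp: tile_def ends_def)
qed

lemma tile_mono: "n \<le> k \<Longrightarrow> tile n \<subseteq> tile k"
  by (auto simp: tile_def)

lemma tile_upd: "x \<in> tile n \<Longrightarrow> k < n \<Longrightarrow> c < m k \<Longrightarrow> x(k := c) \<in> tile n"
  by (auto simp: tile_def ends_def)

lemma tile_digit: "x \<in> tile n \<Longrightarrow> n \<le> i \<Longrightarrow> x i = 0"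
  by (simp add: tile_def)

lemma tile_Suc_upd: "x \<in> tile n \<Longrightarrow> c < m n \<Longrightarrow> x(n := c) \<in> tile (Suc n)"
  by (auto simp: tile_def ends_def)

lemma tile_Suc_cases:
  assumes "x \<in> tile (Suc n)"
  obtains y c where "y \<in> tile n" "c < m n" "x = y(n := c)"
proof -
  have "0 < m n" using degree_ge[of n] by simp
  then have "x(n := 0) \<in> tile n" using assms by (auto simp: tile_def ends_def)
  moreover have "x n < m n" using assms by (auto simp: tile_def ends_def)
  ultimately show ?thesis using that[of "x(n := 0)" "x n"] by simp
qed

lemma tile_Suc_bij:
  "bij_betw (\<lambda>(x, c). x(n := c)) (tile n \<times> {..<m n}) (tile (Suc n))"
proof (rule bij_betwI')
  fix a b assume "a \<in> tile n \<times> {..<m n}" "b \<in> tile n \<times> {..<m n}"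
  then have z: "fst a n = 0" "fst b n = 0" by (auto simp: tile_digit)
  have "fst a = fst b \<and> snd a = snd b"
    if *: "(fst a)(n := snd a) = (fst b)(n := snd b)"
  proof
    show "fst a = fst b"
    proof
      fix i show "fst a i = fst b i"
        using fun_cong[OF *, of i] z by (cases "i = n") auto
    qed
    show "snd a = snd b" using fun_cong[OF *, of n] by simp
  qed
  then show "((case a of (x, c) \<Rightarrow> x(n := c)) = (case b of (x, c) \<Rightarrow> x(n := c))) = (a = b)"
    by (auto simp: split_def prod_eq_iff)
next
  fix a assume "a \<in> tile n \<times> {..<m n}"
  then show "(case a of (x, c) \<Rightarrow> x(n := c)) \<in> tile (Suc n)"
    by (auto intro: tile_Suc_upd)
next
  fix x assume "x \<in> tile (Suc n)"
  then obtain y c where "y \<in> tile n" "c < m n" "x = y(n := c)"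
    by (rule tile_Suc_cases)
  then show "\<exists>a\<in>tile n \<times> {..<m n}. x = (case a of (x, c) \<Rightarrow> x(n := c))"
    by (intro bexI[of _ "(y, c)"]) auto
qed

lemma finite_tile [simp]: "finite (tile n)"
proof (induction n)
  case (Suc n)
  then show ?case using bij_betw_finite[OF tile_Suc_bij[of n]] by simp
qed (simp add: tile_0)

lemma sum_tile_Suc: "(\<Sum>x\<in>tile (Suc n). G x) = (\<Sum>x\<in>tile n. \<Sum>c<m n. G (x(n := c)))"
  by (simp add: sum.reindex_bij_betw[OF tile_Suc_bij, symmetric] sum.cartesian_product split_def)

text \<open>
  Everything below distinguishes only whether a digit is zero.
\<close>

lemma sum_digits:
  fixes g :: "nat \<Rightarrow> real"
  assumes "\<And>c. 0 < c \<Longrightarrow> c < m n \<Longrightarrow> g c = y"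
  shows "(\<Sum>c<m n. g c) = g 0 + (real (m n) - 1) * y"
proof -
  have eq: "{..<m n} = insert 0 {1..<m n}" using degree_ge[of n] by auto
  have "(\<Sum>c<m n. g c) = g 0 + (\<Sum>c=1..<m n. g c)"
    unfolding eq by simp
  also have "(\<Sum>c=1..<m n. g c) = (\<Sum>c=1..<m n. y)"
    using assms by (intro sum.cong) auto
  finally show ?thesis using degree_ge[of n] by (simp add: of_nat_diff)
qed

section \<open>The potential\<close>

text \<open>
  Current that flows from the origin through the copy with digit \<open>n\<close> equal to zero divides equally among
  the \<open>m n - 1\<close> other copies; this is the fraction that each of them receives.
\<close>

definition share :: "nat \<Rightarrow> real" where
  "share n = 1 / (real (m n) - 1)"

lemma degree_real: "1 \<le> real (m n) - 1" "real (m n) - 1 \<le> real M"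
  using degree_ge[of n] degree_le[of n] by auto

lemma M_ge: "2 \<le> real M"
  using degree_ge[of 0] degree_le[of 0] by linarith

lemma share_bounds: "0 < share n" "share n \<le> 1" "1 / real M \<le> share n"
  using degree_real[of n] M_ge by (auto simp: share_def field_simps)

lemma share_degree: "(real (m n) - 1) * share n = 1"
  using degree_real[of n] by (simp add: share_def)

text \<open>
  \<open>pot n\<close> is a potential on the tile of level \<open>n\<close> that grows from \<open>0\<close> at the origin to \<open>len n\<close> at the far
  end \<open>0\<dots>0c\<close>. In the copies with nonzero digit \<open>n\<close> it continues past \<open>len n\<close> along the reversed tile, since
  a nonzero copy is entered at its far end, with the slope reduced by \<open>share n\<close>. For binary digits
  \<open>pot\<close> is the rank in the reflected Gray code, rounded up to an even number.
\<close>

primrec len :: "nat \<Rightarrow> real" where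
  "len 0 = 1"
| "len (Suc n) = (1 + share n) * len n"

primrec pot :: "nat \<Rightarrow> (nat \<Rightarrow> nat) \<Rightarrow> real" where
  "pot 0 x = 0"
| "pot (Suc n) x = (if x n = 0 then pot n x else len n + share n * (len n - pot n x))"

lemma len_pos [simp]: "0 < len n"
proof (induction n)
  case (Suc n)
  have "0 < 1 + share n" using share_bounds(1)[of n] by simp
  with Suc show ?case by simp
qed simp

lemma len_nonneg [simp]: "0 \<le> len n"
  using len_pos[of n] by linarith

lemma len_nonzero [simp]: "len n \<noteq> 0"
  using len_pos[of n] by linarith

lemma len_mono: "len n \<le> len (Suc n)"
  using share_bounds(1)[of n] by (simp add: algebra_simps)

text \<open>
  The lengths grow at least geometrically because the degrees are bounded. This makes all the sums over
  scales below comparable to their last term.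
\<close>

lemma len_ratio: "len n \<le> real M / (real M + 1) * len (Suc n)"
proof -
  have "(1 + 1 / real M) * len n \<le> len (Suc n)"
    using share_bounds(3)[of n] by (simp add: mult_right_mono)
  then have "real M / (real M + 1) * ((1 + 1 / real M) * len n) \<le> real M / (real M + 1) * len (Suc n)"
    using M_ge by (intro mult_left_mono) auto
  moreover have "1 + 1 / real M = (real M + 1) / real M" "0 < real M" "0 < real M + 1"
    using M_ge by (auto simp: add_divide_distrib)
  then have "real M / (real M + 1) * ((1 + 1 / real M) * len n) = len n"
    by simp
  ultimately show ?thesis by simp
qed

lemma len_sq_ratio: "(len n)\<^sup>2 \<le> real M / (real M + 1) * (len (Suc n))\<^sup>2"
proof -
  have "len n * len n \<le> (real M / (real M + 1) * len (Suc n)) * len (Suc n)"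
    using M_ge by (intro mult_mono len_ratio len_mono) (auto simp del: len.simps)
  then show ?thesis by (simp add: power2_eq_square mult.assoc del: len.simps)
qed

lemma pot_bounds: "0 \<le> pot n x \<and> pot n x \<le> len n"
proof (induction n)
  case (Suc n)
  have "0 \<le> share n * (len n - pot n x)" "share n * (len n - pot n x) \<le> share n * len n"
    using Suc share_bounds(1)[of n] by auto
  then show ?case using Suc len_pos[of n] len_mono[of n]
    by (auto simp: algebra_simps)
qed simp

lemma pot_upd [simp]: "n \<le> k \<Longrightarrow> pot n (x(k := c)) = pot n x"
  by (induction n) auto

definition nonzeros :: "nat \<Rightarrow> (nat \<Rightarrow> nat) \<Rightarrow> nat" where
  "nonzeros n x = card {i. i < n \<and> x i \<noteq> 0}"

lemma nonzeros_0 [simp]: "nonzeros 0 x = 0"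
  by (simp add: nonzeros_def)

lemma nonzeros_Suc: "nonzeros (Suc n) x = (if x n = 0 then nonzeros n x else Suc (nonzeros n x))"
proof -
  have "{i. i < Suc n \<and> x i \<noteq> 0} =
      (if x n = 0 then {i. i < n \<and> x i \<noteq> 0} else insert n {i. i < n \<and> x i \<noteq> 0})"
    by (auto simp: less_Suc_eq)
  then show ?thesis by (simp add: nonzeros_def)
qed

lemma nonzeros_upd [simp]: "n \<le> k \<Longrightarrow> nonzeros n (x(k := c)) = nonzeros n x"
  unfolding nonzeros_def by (intro arg_cong[of _ _ card]) auto

text \<open>
  A generator of degree at most \<open>2\<close> changes the digit following the first, second or third nonzero one, or
  the digit at position \<open>0\<close>. So the digit \<open>k > 0\<close> can change only if its predecessor is nonzero and there are at
  most three nonzero digits before it; that it depends only on the digits below \<open>k\<close> makes the energy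
  self-similar.
\<close>

definition active :: "(nat \<Rightarrow> nat) \<Rightarrow> nat \<Rightarrow> bool" where
  "active x k \<longleftrightarrow> k = 0 \<or> x (k - 1) \<noteq> 0 \<and> nonzeros k x \<le> 3"

lemma active_upd: "k \<le> n \<Longrightarrow> active (x(n := c)) k = active x k"
  by (auto simp: active_def)

section \<open>Self-similar energy\<close>

text \<open>
  The energy of the edges inside the tile of level \<open>n\<close>, where the set of generators is replaced by all
  changes of a single active digit.
\<close>

definition energy :: "nat \<Rightarrow> ((nat \<Rightarrow> nat) \<Rightarrow> real) \<Rightarrow> real" where
  "energy n F = (\<Sum>x\<in>tile n. \<Sum>k<n. if active x k then \<Sum>c<m k. (F (x(k := c)) - F x)\<^sup>2 else 0)"

lemma energy_nonneg: "0 \<le> energy n F"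
  unfolding energy_def by (intro sum_nonneg) (auto intro: sum_nonneg)

text \<open>
  A sum over the vertices of the tile of level \<open>n\<close> at which edges leave it, that is, at which digit \<open>n\<close> can
  change.
\<close>

definition gap :: "nat \<Rightarrow> ((nat \<Rightarrow> nat) \<Rightarrow> real) \<Rightarrow> real" where
  "gap n D = (\<Sum>x\<in>tile n. if active x n then (D x)\<^sup>2 else 0)"

text \<open>
  If \<open>F'\<close> continues \<open>F\<close> affinely in the potential on the nonzero copies, each nonzero copy contributes a
  multiple of the energy of the potential, the edges among the nonzero copies contribute nothing, and the
  edges between them and the zero copy contribute the squared jump, once for each orientation.
\<close>

lemma energy_Suc:
  assumes F0: "\<And>x. x \<in> tile n \<Longrightarrow> F' x = F x"
    and F1: "\<And>x c. x \<in> tile n \<Longrightarrow> 0 < c \<Longrightarrow> c < m n \<Longrightarrow> F' (x(n := c)) = a - b * pot n x"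
  shows "energy (Suc n) F' = energy n F + (real (m n) - 1) * b\<^sup>2 * energy n (pot n)
    + 2 * (real (m n) - 1) * gap n (\<lambda>x. a - b * pot n x - F x)"
proof -
  let ?E = "\<lambda>F x. \<Sum>k<n. if active x k then \<Sum>c<m k. (F (x(k := c)) - F x)\<^sup>2 else 0"
  have inner: "(\<Sum>c0<m n. \<Sum>k<Suc n. if active (x(n := c0)) k
        then \<Sum>c<m k. (F' (x(n := c0, k := c)) - F' (x(n := c0)))\<^sup>2 else 0)
      = ?E F x + (real (m n) - 1) * b\<^sup>2 * ?E (pot n) x
        + 2 * (real (m n) - 1) * (if active x n then (a - b * pot n x - F x)\<^sup>2 else 0)"
    if x: "x \<in> tile n" for x
  proof -
    let ?I = "\<lambda>c0. \<Sum>k<n. if active x k then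
      \<Sum>c<m k. (F' (x(n := c0, k := c)) - F' (x(n := c0)))\<^sup>2 else 0"
    let ?J = "\<lambda>c0. if active x n then \<Sum>c<m n. (F' (x(n := c)) - F' (x(n := c0)))\<^sup>2 else 0"
    have x0: "x(n := 0) = x" using x by (auto simp: tile_digit)
    \<comment> \<open>\<open>?I\<close> collects the edges inside the copy with digit \<open>c0\<close>, and \<open>?J\<close> those that change the digit
      \<open>n\<close>.\<close>
    have I0: "?I 0 = ?E F x"
      using x by (intro sum.cong if_cong refl) (auto simp: x0 F0 tile_upd)
    have I1: "?I c0 = b\<^sup>2 * ?E (pot n) x" if c0: "0 < c0" "c0 < m n" for c0
    proof -
      have "(F' (x(n := c0, k := c)) - F' (x(n := c0)))\<^sup>2
          = b\<^sup>2 * (pot n (x(k := c)) - pot n x)\<^sup>2" if "k < n" "c < m k" for k c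
      proof -
        have "F' (x(n := c0, k := c)) = F' (x(k := c, n := c0))"
          using that by (simp add: fun_upd_twist)
        also have "\<dots> = a - b * pot n (x(k := c))"
          using x c0 that by (intro F1 tile_upd) auto
        finally have "F' (x(n := c0, k := c)) - F' (x(n := c0))
            = - (b * (pot n (x(k := c)) - pot n x))"
          using F1[OF x c0] by (simp add: algebra_simps)
        then show ?thesis by (simp add: power_mult_distrib)
      qed
      then show ?thesis
        unfolding sum_distrib_left by (intro sum.cong refl) (auto simp: sum_distrib_left)
    qed
    have J0: "?J 0 = (real (m n) - 1) * (if active x n then (a - b * pot n x - F x)\<^sup>2 else 0)"
      by (subst sum_digits[where y = "(a - b * pot n x - F x)\<^sup>2"]) (auto simp: x0 F0 F1 x)
    have J1: "?J c0 = (if active x n then (a - b * pot n x - F x)\<^sup>2 else 0)"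
      if c0: "0 < c0" "c0 < m n" for c0
      by (subst sum_digits[where y = 0]) (auto simp: x0 F0 F1 x c0 power2_commute)
    have "(\<Sum>c0<m n. \<Sum>k<Suc n. if active (x(n := c0)) k
        then \<Sum>c<m k. (F' (x(n := c0, k := c)) - F' (x(n := c0)))\<^sup>2 else 0)
      = (\<Sum>c0<m n. ?I c0 + ?J c0)"
      unfolding sum.lessThan_Suc
      by (intro sum.cong refl arg_cong2[where f = "(+)"]) (auto simp: active_upd)
    also have "\<dots> = ?I 0 + ?J 0 + (real (m n) - 1) *
        (b\<^sup>2 * ?E (pot n) x + (if active x n then (a - b * pot n x - F x)\<^sup>2 else 0))"
      by (rule sum_digits) (use I1 J1 in presburger)
    finally show ?thesis
      unfolding I0 J0 by (simp add: algebra_simps)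
  qed
  have "energy (Suc n) F' = (\<Sum>x\<in>tile n. \<Sum>c0<m n. \<Sum>k<Suc n. if active (x(n := c0)) k
        then \<Sum>c<m k. (F' (x(n := c0, k := c)) - F' (x(n := c0)))\<^sup>2 else 0)"
    unfolding energy_def by (rule sum_tile_Suc)
  also have "\<dots> = (\<Sum>x\<in>tile n. ?E F x + (real (m n) - 1) * b\<^sup>2 * ?E (pot n) x
        + 2 * (real (m n) - 1) * (if active x n then (a - b * pot n x - F x)\<^sup>2 else 0))"
    by (intro sum.cong refl inner)
  finally show ?thesis
    by (simp only: sum.distrib sum_distrib_left[symmetric] energy_def gap_def)
qed

definition sparse_sum :: "nat \<Rightarrow> nat \<Rightarrow> ((nat \<Rightarrow> nat) \<Rightarrow> real) \<Rightarrow> real" where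
  "sparse_sum n j G = (\<Sum>x\<in>tile n. if nonzeros n x \<le> j then G x else 0)"

lemma sparse_sum_Suc:
  assumes "\<And>x c. x \<in> tile n \<Longrightarrow> 0 < c \<Longrightarrow> c < m n \<Longrightarrow> G (x(n := c)) = G' x"
  shows "sparse_sum (Suc n) (Suc j) G
    = sparse_sum n (Suc j) G + (real (m n) - 1) * sparse_sum n j G'"
proof -
  have "sparse_sum (Suc n) (Suc j) G = (\<Sum>x\<in>tile n. \<Sum>c<m n.
      if nonzeros (Suc n) (x(n := c)) \<le> Suc j then G (x(n := c)) else 0)"
    unfolding sparse_sum_def by (rule sum_tile_Suc)
  also have "\<dots> = (\<Sum>x\<in>tile n. (if nonzeros n x \<le> Suc j then G x else 0)
      + (real (m n) - 1) * (if nonzeros n x \<le> j then G' x else 0))"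
  proof (intro sum.cong refl)
    fix x assume x: "x \<in> tile n"
    then have x0: "x(n := 0) = x" by (auto simp: tile_digit)
    show "(\<Sum>c<m n. if nonzeros (Suc n) (x(n := c)) \<le> Suc j then G (x(n := c)) else 0)
      = (if nonzeros n x \<le> Suc j then G x else 0) + (real (m n) - 1) * (if nonzeros n x \<le> j then G' x else 0)"
      by (subst sum_digits[where y = "if nonzeros n x \<le> j then G' x else 0"])
        (use x in \<open>auto simp: nonzeros_Suc x0 assms tile_digit\<close>)
  qed
  finally show ?thesis
    by (simp only: sum.distrib sum_distrib_left[symmetric] sparse_sum_def)
qed

lemma sparse_sum_mono:
  assumes "\<And>x. x \<in> tile n \<Longrightarrow> G x \<le> G' x"
  shows "sparse_sum n j G \<le> sparse_sum n j G'"
  unfolding sparse_sum_def using assms by (intro sum_mono) auto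

lemma sparse_count_0: "sparse_sum n 0 (\<lambda>_. 1) = 1"
proof (induction n)
  case (Suc n)
  have "sparse_sum (Suc n) 0 (\<lambda>_. 1) = (\<Sum>x\<in>tile n. \<Sum>c<m n.
      if nonzeros (Suc n) (x(n := c)) \<le> 0 then 1 else 0)"
    unfolding sparse_sum_def by (rule sum_tile_Suc)
  also have "\<dots> = sparse_sum n 0 (\<lambda>_. 1)"
    unfolding sparse_sum_def
    by (intro sum.cong refl, subst sum_digits[where y = 0]) (auto simp: nonzeros_Suc)
  finally show ?case using Suc by simp
qed (simp add: sparse_sum_def tile_0)

text \<open>
  A vertex with a single nonzero digit is given by the position and the value of this digit.
\<close>

lemma sparse_count_1: "sparse_sum n 1 (\<lambda>_. 1) \<le> 1 + real n * real M"
proof (induction n)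
  case (Suc n)
  have "sparse_sum (Suc n) 1 (\<lambda>_. 1) = sparse_sum n 1 (\<lambda>_. 1) + (real (m n) - 1)"
    using sparse_sum_Suc[of n "\<lambda>_. 1" "\<lambda>_. 1" 0] by (simp add: sparse_count_0)
  then show ?case using Suc degree_real(2)[of n] by (simp add: algebra_simps)
qed (simp add: sparse_sum_def tile_0)

text \<open>
  With the top digit at position \<open>b\<close> there are at most linearly many vertices with two nonzero digits, all
  of potential at most \<open>len (b + 1)\<close>. Since the squared lengths grow geometrically, the sum over \<open>b\<close> is of
  the order of its last term. One more permitted nonzero digit would turn the factor \<open>n\<close> into \<open>n\<^sup>2\<close>.
\<close>

lemma sparse_sum_pot:
  "sparse_sum n 2 (\<lambda>x. (pot n x)\<^sup>2) \<le> (real M)\<^sup>2 * (real M + 1) * (real n + 1) * (len n)\<^sup>2"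
proof (induction n)
  case (Suc n)
  let ?r = "real M / (real M + 1)" and ?C = "(real M)\<^sup>2 * (real M + 1)"
  let ?G' = "\<lambda>x. (len n + share n * (len n - pot n x))\<^sup>2"
  have "sparse_sum (Suc n) 2 (\<lambda>x. (pot (Suc n) x)\<^sup>2)
      = sparse_sum n 2 (\<lambda>x. (pot (Suc n) x)\<^sup>2) + (real (m n) - 1) * sparse_sum n 1 ?G'"
    using sparse_sum_Suc[of n "\<lambda>x. (pot (Suc n) x)\<^sup>2" ?G' 1] by (simp add: numeral_2_eq_2)
  also have "sparse_sum n 2 (\<lambda>x. (pot (Suc n) x)\<^sup>2) = sparse_sum n 2 (\<lambda>x. (pot n x)\<^sup>2)"
    unfolding sparse_sum_def by (intro sum.cong refl) (auto simp: tile_digit)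
  also have "\<dots> \<le> ?C * (real n + 1) * (len n)\<^sup>2" by (rule Suc)
  also have "\<dots> \<le> ?C * (real n + 1) * (?r * (len (Suc n))\<^sup>2)"
    using M_ge by (intro mult_left_mono len_sq_ratio) auto
  finally have old: "sparse_sum (Suc n) 2 (\<lambda>x. (pot (Suc n) x)\<^sup>2)
      \<le> ?C * (real n + 1) * (?r * (len (Suc n))\<^sup>2) + (real (m n) - 1) * sparse_sum n 1 ?G'"
    by simp
  have "sparse_sum n 1 ?G' \<le> sparse_sum n 1 (\<lambda>_. (len (Suc n))\<^sup>2)"
  proof (intro sparse_sum_mono power_mono)
    fix x
    have "share n * (len n - pot n x) \<le> share n * len n"
      using share_bounds(1)[of n] pot_bounds[of n x] by (intro mult_left_mono) auto
    then show "len n + share n * (len n - pot n x) \<le> len (Suc n)"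
      by (simp add: algebra_simps)
    show "0 \<le> len n + share n * (len n - pot n x)"
      using share_bounds(1)[of n] pot_bounds[of n x] by (intro add_nonneg_nonneg mult_nonneg_nonneg) auto
  qed
  also have "\<dots> = (len (Suc n))\<^sup>2 * sparse_sum n 1 (\<lambda>_. 1)"
    by (simp add: sparse_sum_def sum_distrib_left if_distrib cong: if_cong)
  also have "\<dots> \<le> (len (Suc n))\<^sup>2 * (1 + real n * real M)"
    by (intro mult_left_mono sparse_count_1) auto
  also have "\<dots> \<le> (len (Suc n))\<^sup>2 * (real M * (real n + 1))"
    using M_ge by (intro mult_left_mono) (auto simp: algebra_simps)
  finally have "(real (m n) - 1) * sparse_sum n 1 ?G'
      \<le> real M * ((len (Suc n))\<^sup>2 * (real M * (real n + 1)))"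
    using degree_real[of n] M_ge by (intro mult_mono)
      (auto simp: sparse_sum_def simp del: len.simps intro!: sum_nonneg)
  with old have "sparse_sum (Suc n) 2 (\<lambda>x. (pot (Suc n) x)\<^sup>2)
      \<le> ?C * (real n + 1) * (?r * (len (Suc n))\<^sup>2)
        + real M * ((len (Suc n))\<^sup>2 * (real M * (real n + 1)))"
    by linarith
  \<comment> \<open>The constant \<open>?C\<close> solves \<open>?C * ?r + (real M)\<^sup>2 = ?C\<close>.\<close>
  also have "?C * (real n + 1) * (?r * (len (Suc n))\<^sup>2)
      + real M * ((len (Suc n))\<^sup>2 * (real M * (real n + 1)))
      = ?C * (real n + 1) * (len (Suc n))\<^sup>2"
    using M_ge by (simp add: divide_simps del: len.simps) (simp add: algebra_simps power2_eq_square)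
  also have "\<dots> \<le> ?C * (real (Suc n) + 1) * (len (Suc n))\<^sup>2"
    using M_ge by (intro mult_right_mono mult_left_mono) auto
  finally show ?case .
qed (simp add: sparse_sum_def tile_0)

definition mirror_sum :: "nat \<Rightarrow> real" where
  "mirror_sum n = gap n (\<lambda>x. len n - pot n x)"

definition mirror_const :: real where
  "mirror_const = (real M)\<^sup>2 * (real M + 1)"

lemma mirror_const_ge: "1 \<le> mirror_const"
proof -
  have "1 \<le> (real M)\<^sup>2" using M_ge by (intro one_le_power) auto
  then have "1 * 1 \<le> mirror_const" unfolding mirror_const_def by (intro mult_mono) auto
  then show ?thesis by simp
qed

lemma mirror_const_nonneg [simp]: "0 \<le> mirror_const"
  using mirror_const_ge by simp

text \<open>
  A vertex at which digit \<open>n\<close> can change has a nonzero digit \<open>n - 1\<close>, so it lies in a reversed copy, where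
  the distance to the far end is a multiple of the potential one level below; and there it has at most
  two further nonzero digits.
\<close>

lemma mirror_sum_bound: "mirror_sum n \<le> mirror_const * (real n + 1) * (len n)\<^sup>2"
proof (cases n)
  case 0
  then show ?thesis using mirror_const_ge by (simp add: mirror_sum_def gap_def tile_0 active_def)
next
  case (Suc p)
  have "mirror_sum n = (\<Sum>x\<in>tile p. \<Sum>c<m p. if active (x(p := c)) n
      then (len n - pot n (x(p := c)))\<^sup>2 else 0)"
    unfolding mirror_sum_def gap_def Suc by (rule sum_tile_Suc)
  also have "\<dots> = (\<Sum>x\<in>tile p. (real (m p) - 1) * (if nonzeros p x \<le> 2 then (share p * pot p x)\<^sup>2 else 0))"
  proof (intro sum.cong refl)
    fix x assume x: "x \<in> tile p"
    have "len n - pot n (x(p := c)) = share p * pot p x" if "0 < c" for c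
      using that by (simp add: Suc algebra_simps)
    then show "(\<Sum>c<m p. if active (x(p := c)) n then (len n - pot n (x(p := c)))\<^sup>2 else 0)
      = (real (m p) - 1) * (if nonzeros p x \<le> 2 then (share p * pot p x)\<^sup>2 else 0)"
      by (subst sum_digits[where y = "if nonzeros p x \<le> 2 then (share p * pot p x)\<^sup>2 else 0"])
        (auto simp: Suc active_def nonzeros_Suc simp del: pot.simps)
  qed
  also have "\<dots> \<le> (\<Sum>x\<in>tile p. if nonzeros p x \<le> 2 then (pot p x)\<^sup>2 else 0)"
  proof (intro sum_mono)
    fix x
    have "(real (m p) - 1) * (share p * pot p x)\<^sup>2 = share p * (pot p x)\<^sup>2"
      using share_degree[of p] by (simp add: power2_eq_square mult.assoc[symmetric])
    also have "\<dots> \<le> 1 * (pot p x)\<^sup>2"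
      using share_bounds[of p] by (intro mult_right_mono) auto
    finally show "(real (m p) - 1) * (if nonzeros p x \<le> 2 then (share p * pot p x)\<^sup>2 else 0)
      \<le> (if nonzeros p x \<le> 2 then (pot p x)\<^sup>2 else 0)" by simp
  qed
  also have "\<dots> \<le> mirror_const * (real p + 1) * (len p)\<^sup>2"
    using sparse_sum_pot by (simp add: sparse_sum_def mirror_const_def)
  also have "\<dots> \<le> mirror_const * (real n + 1) * (len n)\<^sup>2"
    unfolding Suc using mirror_const_ge
    by (intro mult_mono power_mono len_mono) (auto simp del: len.simps)
  finally show ?thesis .
qed

lemma gap_nonneg: "0 \<le> gap n D"
  unfolding gap_def by (intro sum_nonneg) auto

lemma gap_cmult: "gap n (\<lambda>x. a * D x) = a\<^sup>2 * gap n D"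
  unfolding gap_def sum_distrib_left by (intro sum.cong refl) (auto simp: power_mult_distrib)

text \<open>
  From one level to the next, the energy of the old edges grows by the same factor as the length, because
  the \<open>m n - 1\<close> new copies have slope \<open>share n\<close>. So relative to the squared length it contracts by a
  constant factor, and the edges that change digit \<open>n\<close> add an amount linear in \<open>n\<close>.
\<close>

lemma energy_pot: "energy n (pot n) \<le> 2 * real M * mirror_const * (real M + 1) * (real n + 1) * (len n)\<^sup>2"
proof (induction n)
  case 0
  show ?case using M_ge by (simp add: energy_def)
next
  case (Suc n)
  let ?K = "2 * real M * mirror_const * (real M + 1)" and ?r = "real M / (real M + 1)"
  let ?L = "len (Suc n)"
  have K_nonneg: "0 \<le> ?K" by (intro mult_nonneg_nonneg) auto
  have "energy (Suc n) (pot (Suc n)) = energy n (pot n)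
      + (real (m n) - 1) * (share n)\<^sup>2 * energy n (pot n)
      + 2 * (real (m n) - 1) * gap n (\<lambda>x. ?L - share n * pot n x - pot n x)"
    by (rule energy_Suc) (auto simp: tile_digit algebra_simps)
  also have "(real (m n) - 1) * (share n)\<^sup>2 = share n"
    using share_degree[of n] by (simp add: power2_eq_square mult.assoc[symmetric])
  also have "(\<lambda>x. ?L - share n * pot n x - pot n x) = (\<lambda>x. (1 + share n) * (len n - pot n x))"
    by (simp add: algebra_simps)
  also have "gap n \<dots> = (1 + share n)\<^sup>2 * mirror_sum n"
    unfolding gap_cmult mirror_sum_def ..
  finally have rec: "energy (Suc n) (pot (Suc n)) = (1 + share n) * energy n (pot n)
      + 2 * (real (m n) - 1) * ((1 + share n)\<^sup>2 * mirror_sum n)"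
    by (simp add: algebra_simps del: pot.simps)
  have "(1 + share n) * energy n (pot n) \<le> (1 + share n) * (?K * (real n + 1) * (len n)\<^sup>2)"
    using share_bounds(1)[of n] Suc by (intro mult_left_mono) auto
  also have "\<dots> = ?K * (real n + 1) * (len n * ?L)"
    by (simp add: power2_eq_square)
  also have "\<dots> \<le> ?K * (real n + 1) * ((?r * ?L) * ?L)"
    using K_nonneg by (intro mult_left_mono mult_right_mono len_ratio) (auto simp del: len.simps)
  finally have 1: "(1 + share n) * energy n (pot n) \<le> ?K * (real n + 1) * (?r * ?L\<^sup>2)"
    by (simp add: power2_eq_square mult.assoc del: len.simps)
  have "(1 + share n)\<^sup>2 * mirror_sum n \<le> (1 + share n)\<^sup>2 * (mirror_const * (real n + 1) * (len n)\<^sup>2)"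
    by (intro mult_left_mono mirror_sum_bound) auto
  also have "\<dots> = mirror_const * (real n + 1) * ?L\<^sup>2"
    by (simp add: power_mult_distrib)
  finally have "2 * (real (m n) - 1) * ((1 + share n)\<^sup>2 * mirror_sum n)
      \<le> 2 * real M * (mirror_const * (real n + 1) * ?L\<^sup>2)"
    by (rule mult_mono[rotated]) (use degree_real[of n] in \<open>auto simp: mirror_sum_def gap_nonneg\<close>)
  with 1 have "energy (Suc n) (pot (Suc n))
      \<le> ?K * (real n + 1) * (?r * ?L\<^sup>2) + 2 * real M * (mirror_const * (real n + 1) * ?L\<^sup>2)"
    unfolding rec by linarith
  \<comment> \<open>The constant \<open>?K\<close> solves \<open>?K * ?r + 2 * real M * mirror_const = ?K\<close>.\<close>
  also have "\<dots> = ?K * (real n + 1) * ?L\<^sup>2"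
    using M_ge by (simp add: divide_simps del: len.simps) (simp add: algebra_simps del: len.simps)
  also have "\<dots> \<le> ?K * (real (Suc n) + 1) * ?L\<^sup>2"
    using K_nonneg by (intro mult_right_mono mult_left_mono) auto
  finally show ?case .
qed

section \<open>Functions of small energy\<close>

definition level_value :: "(nat \<Rightarrow> real) \<Rightarrow> nat \<Rightarrow> real" where
  "level_value w n = (\<Sum>i<n. w i)"

lemma level_value_Suc: "level_value w (Suc n) = level_value w n + w n"
  by (simp add: level_value_def)

text \<open>
  The function \<open>pot\<close> composed with the piecewise linear map for which crossing from level \<open>n\<close> to level
  \<open>n + 1\<close> costs \<open>w n\<close>: on the nonzero copies of level \<open>n\<close>, \<^term>\<open>1 - pot n x / len n\<close> is the fraction of
  the way covered from their entrance at the far end.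
\<close>

primrec stretch :: "(nat \<Rightarrow> real) \<Rightarrow> nat \<Rightarrow> (nat \<Rightarrow> nat) \<Rightarrow> real" where
  "stretch w 0 x = 0"
| "stretch w (Suc n) x = (if x n = 0 then stretch w n x
    else level_value w n + w n * (1 - pot n x / len n))"

lemma stretch_tile:
  assumes "x \<in> tile n" "n \<le> k"
  shows "stretch w k x = stretch w n x"
  using assms(2) by (induction k rule: dec_induct) (auto simp: tile_digit[OF assms(1)])

lemma stretch_bounds:
  assumes "\<And>i. 0 \<le> w i"
  shows "0 \<le> stretch w n x \<and> stretch w n x \<le> level_value w n"
proof (induction n)
  case (Suc n)
  have p: "0 \<le> pot n x / len n" "pot n x / len n \<le> 1"
    using pot_bounds[of n x] len_pos[of n] by auto
  then have "0 \<le> w n * (1 - pot n x / len n)" "w n * (1 - pot n x / len n) \<le> w n * 1"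
    using assms[of n] by (auto intro!: mult_left_mono simp del: mult_1_right)
  moreover have "0 \<le> level_value w n"
    using assms by (simp add: level_value_def sum_nonneg)
  ultimately show ?case
    using Suc assms[of n] by (auto simp: level_value_Suc)
qed (simp add: level_value_def)

text \<open>
  At a vertex where digit \<open>n\<close> can change, \<open>stretch\<close> misses \<open>level_value w n\<close> by the weight of the previous
  level times the remaining fraction of its copy, so the jump along the new edges is governed by the two
  adjacent weights and by the same distance that enters \<open>mirror_sum\<close>.
\<close>

lemma stretch_gap:
  assumes w: "\<And>i. 0 \<le> w i" and x: "x \<in> tile n" "active x n"
  shows "(level_value w (Suc n) - w n / len n * pot n x - stretch w n x)\<^sup>2
    \<le> 2 * (real M)\<^sup>2 * ((w n)\<^sup>2 + (w (n - 1))\<^sup>2) / (len n)\<^sup>2 * (len n - pot n x)\<^sup>2"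
proof -
  let ?y = "(len n - pot n x) / len n"
  have y: "0 \<le> ?y" using pot_bounds[of n x] by simp
  have "0 \<le> level_value w (Suc n) - w n / len n * pot n x - stretch w n x \<and>
    level_value w (Suc n) - w n / len n * pot n x - stretch w n x
      \<le> (w n + real M * w (n - 1)) * ?y"
  proof (cases n)
    case 0
    then show ?thesis using w[of 0] M_ge by (simp add: level_value_def)
  next
    case (Suc p)
    let ?u = "pot p x / len p"
    have xp: "x p \<noteq> 0" using x(2) Suc by (simp add: active_def)
    \<comment> \<open>The remaining fraction \<open>?u\<close> is measured in units of a reversed copy of level \<open>p\<close>, while \<open>?y\<close> is
      measured in units of the whole tile of level \<open>n\<close>.\<close>
    have y_eq: "?y = share p / (1 + share p) * ?u"
      using xp len_pos[of p] by (simp add: Suc algebra_simps)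
    have q1: "(1 + share p) / share p = real (m p)"
      using degree_real[of p] by (simp add: share_def field_simps)
    have u: "?u = real (m p) * ?y"
      unfolding y_eq q1[symmetric] using share_bounds(1)[of p] by simp
    have "level_value w (Suc n) - w n / len n * pot n x - stretch w n x
        = level_value w n + w n * ?y - stretch w n x"
      using len_pos[of n] by (simp add: level_value_Suc field_simps)
    also have "\<dots> = w n * ?y + w p * ?u"
      using xp by (simp add: Suc level_value_Suc algebra_simps)
    also have "\<dots> = (w n + real (m p) * w p) * ?y"
    proof -
      have "a * z + b * (c * z) = (a + c * b) * z" for a b c z :: real
        by (simp add: algebra_simps)
      then show ?thesis unfolding u .
    qed
    finally have eq: "level_value w (Suc n) - w n / len n * pot n x - stretch w n x
        = (w n + real (m p) * w p) * ?y" .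
    have "(w n + real (m p) * w p) * ?y \<le> (w n + real M * w p) * ?y"
      using w[of p] degree_le[of p] y by (intro mult_right_mono add_left_mono) auto
    moreover have "0 \<le> (w n + real (m p) * w p) * ?y"
      using w[of p] w[of n] y by (intro mult_nonneg_nonneg add_nonneg_nonneg) auto
    ultimately show ?thesis unfolding eq by (simp add: Suc)
  qed
  then have "(level_value w (Suc n) - w n / len n * pot n x - stretch w n x)\<^sup>2
      \<le> ((w n + real M * w (n - 1)) * ?y)\<^sup>2"
    by (intro power_mono) auto
  also have "\<dots> = (w n + real M * w (n - 1))\<^sup>2 * ?y\<^sup>2"
    by (rule power_mult_distrib)
  also have "\<dots> \<le> (2 * (real M)\<^sup>2 * ((w n)\<^sup>2 + (w (n - 1))\<^sup>2)) * ?y\<^sup>2"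
  proof (rule mult_right_mono)
    \<comment> \<open>This is \<open>(a + b)\<^sup>2 \<le> 2 * (a\<^sup>2 + b\<^sup>2)\<close>.\<close>
    have "(w n + real M * w (n - 1))\<^sup>2 \<le> 2 * (1 * (w n)\<^sup>2 + (real M)\<^sup>2 * (w (n - 1))\<^sup>2)"
      using zero_le_power2[of "w n - real M * w (n - 1)"]
      by (simp add: power2_diff power2_sum power_mult_distrib algebra_simps)
    also have "\<dots> \<le> 2 * ((real M)\<^sup>2 * (w n)\<^sup>2 + (real M)\<^sup>2 * (w (n - 1))\<^sup>2)"
      using M_ge by (intro mult_left_mono add_right_mono mult_right_mono one_le_power) auto
    finally show "(w n + real M * w (n - 1))\<^sup>2 \<le> 2 * (real M)\<^sup>2 * ((w n)\<^sup>2 + (w (n - 1))\<^sup>2)"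
      by (simp add: algebra_simps)
  qed simp
  finally show ?thesis by (simp add: power_divide)
qed

definition energy_const :: real where
  "energy_const = 2 * real M * mirror_const * (real M + 1) * real M + 4 * (real M)^3 * mirror_const"

text \<open>
  At level \<open>i\<close> the potential has relative energy of order \<open>i\<close>. The weight \<open>w (i - 1)\<close> at \<open>i = 0\<close> reads
  \<open>w 0\<close>, which is harmless in an upper bound.
\<close>

lemma energy_stretch:
  assumes w: "\<And>i. 0 \<le> w i"
  shows "energy n (stretch w n) \<le> energy_const * (\<Sum>i<n. (real i + 1) * ((w i)\<^sup>2 + (w (i - 1))\<^sup>2))"
proof (induction n)
  case 0
  show ?case by (simp add: energy_def)
next
  case (Suc n)
  let ?W = "(w n)\<^sup>2 + (w (n - 1))\<^sup>2"
  have rec: "energy (Suc n) (stretch w (Suc n)) = energy n (stretch w n)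
      + (real (m n) - 1) * (w n / len n)\<^sup>2 * energy n (pot n)
      + 2 * (real (m n) - 1) * gap n (\<lambda>x. level_value w (Suc n) - w n / len n * pot n x - stretch w n x)"
    by (rule energy_Suc) (auto simp: tile_digit level_value_Suc algebra_simps)
  have "(real (m n) - 1) * (w n / len n)\<^sup>2 * energy n (pot n)
      \<le> real M * (w n / len n)\<^sup>2 * (2 * real M * mirror_const * (real M + 1) * (real n + 1) * (len n)\<^sup>2)"
    using degree_real[of n] M_ge mirror_const_ge
    by (intro mult_mono energy_pot energy_nonneg mult_nonneg_nonneg) auto
  also have "\<dots> = 2 * real M * mirror_const * (real M + 1) * real M * ((real n + 1) * (w n)\<^sup>2)"
    using len_pos[of n] by (simp add: power_divide)
  also have "\<dots> \<le> 2 * real M * mirror_const * (real M + 1) * real M * ((real n + 1) * ?W)"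
    by (intro mult_left_mono mult_nonneg_nonneg) auto
  finally have 1: "(real (m n) - 1) * (w n / len n)\<^sup>2 * energy n (pot n)
    \<le> 2 * real M * mirror_const * (real M + 1) * real M * ((real n + 1) * ?W)" .
  have "gap n (\<lambda>x. level_value w (Suc n) - w n / len n * pot n x - stretch w n x)
      \<le> 2 * (real M)\<^sup>2 * ?W / (len n)\<^sup>2 * mirror_sum n"
    unfolding gap_def mirror_sum_def sum_distrib_left
    using stretch_gap[OF w] by (intro sum_mono) auto
  also have "\<dots> \<le> 2 * (real M)\<^sup>2 * ?W / (len n)\<^sup>2 * (mirror_const * (real n + 1) * (len n)\<^sup>2)"
    by (intro mult_left_mono mirror_sum_bound) auto
  also have "\<dots> = 2 * (real M)\<^sup>2 * mirror_const * ((real n + 1) * ?W)"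
    using len_pos[of n] by simp
  finally have "2 * (real (m n) - 1)
        * gap n (\<lambda>x. level_value w (Suc n) - w n / len n * pot n x - stretch w n x)
      \<le> 2 * real M * (2 * (real M)\<^sup>2 * mirror_const * ((real n + 1) * ?W))"
    by (rule mult_mono[rotated]) (use degree_real[of n] in \<open>auto simp: gap_nonneg\<close>)
  also have "\<dots> = 4 * (real M)^3 * mirror_const * ((real n + 1) * ?W)"
    by (simp add: power3_eq_cube power2_eq_square)
  finally have "energy (Suc n) (stretch w (Suc n))
      \<le> energy n (stretch w n) + energy_const * ((real n + 1) * ?W)"
    using 1 unfolding rec energy_const_def distrib_right by linarith
  then show ?case
    using Suc unfolding sum.lessThan_Suc distrib_left[of energy_const] by linarith
qed

text \<open>
  Weights for which the total drop \<open>\<Sum> w i\<close> and the energy \<open>\<Sum> (i + 1) * (w i)\<^sup>2\<close> are both the harmonic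
  number of \<open>N\<close>: dividing by the drop leaves an energy of order \<open>1 / harm N\<close>.
\<close>

definition harmonic_weight :: "nat \<Rightarrow> nat \<Rightarrow> real" where
  "harmonic_weight N i = (if i < N then 1 / (real i + 1) else 0)"

lemma level_value_harmonic:
  "level_value (harmonic_weight N) n = harm (min n N)"
proof -
  have "harm k = (\<Sum>i<k. 1 / (real i + 1))" for k
    unfolding harm_altdef by (intro sum.cong) (auto simp: field_simps)
  moreover have "(\<Sum>i<n. harmonic_weight N i) = (\<Sum>i<min n N. 1 / (real i + 1))"
    unfolding harmonic_weight_def by (intro sum.mono_neutral_cong_right) auto
  ultimately show ?thesis by (simp add: level_value_def)
qed

lemma harmonic_weight_sum:
  assumes "0 < N"
  shows "(\<Sum>i<n. (real i + 1) * ((harmonic_weight N i)\<^sup>2 + (harmonic_weight N (i - 1))\<^sup>2))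
    \<le> 5 * harm N"
proof -
  let ?w = "harmonic_weight N"
  have nonneg: "0 \<le> ?w i" for i by (simp add: harmonic_weight_def)
  have S: "(\<Sum>i<n. ?w i) \<le> harm N" for n
    using level_value_harmonic[of N n] harm_mono[of "min n N" N]
    by (simp add: level_value_def)
  have "(real i + 1) * ((?w i)\<^sup>2 + (?w (i - 1))\<^sup>2) \<le> ?w i + 2 * ?w (i - 1)" for i
  proof -
    have 1: "(real i + 1) * (?w i)\<^sup>2 = ?w i" for i
      by (simp add: harmonic_weight_def power2_eq_square)
    \<comment> \<open>The factor \<open>2\<close> pays for the shift of the index; at \<open>i = 0\<close> there is no shift and room to spare.\<close>
    have "(real i + 1) * (?w (i - 1))\<^sup>2 \<le> (2 * (real (i - 1) + 1)) * (?w (i - 1))\<^sup>2"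
      by (intro mult_right_mono) auto
    also have "\<dots> = 2 * ?w (i - 1)"
      unfolding mult.assoc 1 ..
    finally show ?thesis using 1[of i] unfolding distrib_left by linarith
  qed
  then have "(\<Sum>i<n. (real i + 1) * ((?w i)\<^sup>2 + (?w (i - 1))\<^sup>2)) \<le> (\<Sum>i<n. ?w i + 2 * ?w (i - 1))"
    by (rule sum_mono)
  also have "\<dots> = (\<Sum>i<n. ?w i) + 2 * (\<Sum>i<n. ?w (i - 1))"
    by (simp add: sum.distrib sum_distrib_left)
  finally have "(\<Sum>i<n. (real i + 1) * ((?w i)\<^sup>2 + (?w (i - 1))\<^sup>2))
      \<le> (\<Sum>i<n. ?w i) + 2 * (\<Sum>i<n. ?w (i - 1))" .
  moreover have "(\<Sum>i<n. ?w (i - 1)) \<le> ?w 0 + (\<Sum>i<n - 1. ?w i)"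
    using nonneg by (cases n) (auto simp: sum.lessThan_Suc_shift simp del: sum.lessThan_Suc)
  moreover have "?w 0 \<le> harm N"
    using S[of 1] by simp
  ultimately show ?thesis using S[of n] S[of "n - 1"] by linarith
qed

lemma finitary_ends_tile: "x \<in> finitary_ends m \<Longrightarrow> \<exists>n. x \<in> tile n"
proof -
  assume x: "x \<in> finitary_ends m"
  then obtain n where "\<forall>i\<in>{i. x i \<noteq> 0}. i < n"
    by (auto simp: finitary_ends_def finite_nat_set_iff_bounded)
  with x show ?thesis by (intro exI[of _ n]) (auto simp: tile_def finitary_ends_def)
qed

lemma finite_finitary_ends_tile:
  assumes "finite B" "B \<subseteq> finitary_ends m"
  shows "\<exists>n. B \<subseteq> tile n"
  using assms
proof (induction rule: finite_induct)
  case (insert x B)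
  then obtain n k where "B \<subseteq> tile n" "x \<in> tile k"
    using finitary_ends_tile by blast
  then have "insert x B \<subseteq> tile (max n k)"
    using tile_mono[of n "max n k"] tile_mono[of k "max n k"] by auto
  then show ?case ..
qed simp

lemma energy_cong:
  assumes "\<And>x. x \<in> tile n \<Longrightarrow> F x = a - b * G x"
  shows "energy n F = b\<^sup>2 * energy n G"
  unfolding energy_def sum_distrib_left
proof (intro sum.cong refl)
  fix x k assume x: "x \<in> tile n" and k: "k \<in> {..<n}"
  have "(F (x(k := c)) - F x)\<^sup>2 = b\<^sup>2 * (G (x(k := c)) - G x)\<^sup>2" if "c < m k" for c
  proof -
    have "F (x(k := c)) - F x = - (b * (G (x(k := c)) - G x))"
      using assms[OF tile_upd[OF x _ that]] assms[OF x] k by (simp add: algebra_simps)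
    then show ?thesis by (simp add: power_mult_distrib)
  qed
  then show "(if active x k then \<Sum>c<m k. (F (x(k := c)) - F x)\<^sup>2 else 0)
    = b\<^sup>2 * (if active x k then \<Sum>c<m k. (G (x(k := c)) - G x)\<^sup>2 else 0)"
    by (simp add: sum_distrib_left)
qed

lemma energy_mono: "n \<le> k \<Longrightarrow> energy n F \<le> energy k F"
proof -
  assume nk: "n \<le> k"
  let ?e = "\<lambda>x k. if active x k then \<Sum>c<m k. (F (x(k := c)) - F x)\<^sup>2 else 0"
  have e: "0 \<le> ?e x k" for x k by (auto intro: sum_nonneg)
  have "energy n F \<le> (\<Sum>x\<in>tile n. \<Sum>j<k. ?e x j)"
    unfolding energy_def using nk e by (intro sum_mono sum_mono2) auto
  also have "\<dots> \<le> energy k F"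
    unfolding energy_def using tile_mono[OF nk] e by (intro sum_mono2 sum_nonneg) auto
  finally show ?thesis .
qed

text \<open>
  The function \<open>1 - stretch / H\<close>, where \<open>H\<close> is the total drop, vanishes outside the tile of level \<open>N\<close> and
  tends to \<open>1\<close> at every fixed vertex as \<open>N\<close> grows.
\<close>

lemma low_energy_function:
  assumes v: "v \<in> finitary_ends m" and e: "0 < e"
  shows "\<exists>f :: (nat \<Rightarrow> nat) \<Rightarrow> real. finite {x \<in> finitary_ends m. f x \<noteq> 0} \<and> 1 / 2 \<le> f v \<and>
    (\<forall>n. energy n f \<le> e)"
proof -
  obtain n0 where n0: "v \<in> tile n0" using finitary_ends_tile[OF v] ..
  have K0: "0 \<le> energy_const" unfolding energy_const_def by (intro add_nonneg_nonneg mult_nonneg_nonneg) auto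
  have "filterlim (harm :: nat \<Rightarrow> real) at_top sequentially"
    by (rule harm_at_top)
  then have "eventually (\<lambda>N. max (2 * harm n0) (5 * energy_const / e) \<le> harm N) sequentially"
    unfolding filterlim_at_top by blast
  then have "eventually (\<lambda>N. max (2 * harm n0) (5 * energy_const / e) \<le> harm N \<and> Suc n0 \<le> N) sequentially"
    by (intro eventually_conj eventually_ge_at_top)
  then obtain N where N: "2 * harm n0 \<le> (harm N :: real)" "5 * energy_const / e \<le> harm N" "n0 < N"
    by (auto simp: eventually_sequentially Suc_le_eq)
  let ?w = "harmonic_weight N"
  define H :: real where "H = harm N"
  have H: "0 < H" unfolding H_def using N(3) harm_pos[of N] by simp
  have w: "0 \<le> ?w i" for i by (simp add: harmonic_weight_def)
  have lv: "level_value ?w n = H" if "N \<le> n" for n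
    using that by (simp add: level_value_harmonic H_def)
  define f where "f x = (if x \<in> tile N then 1 - stretch ?w N x / H else 0)" for x
  \<comment> \<open>Beyond level \<open>N\<close> the weights vanish and \<open>stretch\<close> is constantly \<open>H\<close>, so the cut-off in \<open>f\<close> agrees
    with the recursion at all higher levels and the energy bound applies to \<open>f\<close> there.\<close>
  have f_stretch: "f x = 1 - 1 / H * stretch ?w n x" if "N \<le> n" "x \<in> tile n" for n x
    using that
  proof (induction n rule: dec_induct)
    case base
    then show ?case by (simp add: f_def)
  next
    case (step n)
    show ?case
    proof (cases "x n = 0")
      case True
      have "x i = 0" if "n \<le> i" for i
        using True step.prems that by (cases "i = n") (auto simp: tile_def)
      then have "x \<in> tile n" using step.prems by (auto simp: tile_def)
      then show ?thesis using step.IH True by simp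
    next
      case False
      then have "x \<notin> tile N" using step.hyps by (auto simp: tile_digit)
      then show ?thesis using False step.hyps H
        by (simp add: f_def lv) (simp add: harmonic_weight_def)
    qed
  qed
  have "finite {x \<in> finitary_ends m. f x \<noteq> 0}"
    by (rule finite_subset[OF _ finite_tile[of N]]) (auto simp: f_def)
  moreover have "1 / 2 \<le> f v"
  proof -
    have "stretch ?w N v = stretch ?w n0 v"
      using n0 N(3) by (intro stretch_tile) auto
    also have "\<dots> \<le> harm n0"
      using stretch_bounds[of ?w n0 v] w N(3) by (simp add: level_value_harmonic)
    finally have "2 * stretch ?w N v \<le> H"
      using N(1) by (simp add: H_def)
    moreover have "v \<in> tile N" using n0 N(3) tile_mono[of n0 N] by auto
    ultimately show ?thesis using H by (simp add: f_def field_simps)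
  qed
  moreover have "energy n f \<le> e" for n
  proof -
    let ?k = "max n N"
    have "energy n f \<le> energy ?k f" by (rule energy_mono) simp
    also have "\<dots> = (1 / H)\<^sup>2 * energy ?k (stretch ?w ?k)"
      by (rule energy_cong, rule f_stretch) auto
    also have "\<dots> \<le> (1 / H)\<^sup>2 * (energy_const * (5 * H))"
    proof (rule mult_left_mono)
      have "energy ?k (stretch ?w ?k)
          \<le> energy_const * (\<Sum>i<?k. (real i + 1) * ((?w i)\<^sup>2 + (?w (i - 1))\<^sup>2))"
        by (rule energy_stretch) (rule w)
      also have "\<dots> \<le> energy_const * (5 * H)"
        unfolding H_def using N(3) K0 by (intro mult_left_mono harmonic_weight_sum) auto
      finally show "energy ?k (stretch ?w ?k) \<le> energy_const * (5 * H)" .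
    qed simp
    also have "\<dots> = 5 * energy_const / H"
      using H by (simp add: power2_eq_square)
    also have "\<dots> \<le> e"
      using N(2) H e by (simp add: H_def divide_le_eq mult.commute)
    finally show ?thesis .
  qed
  ultimately show ?thesis by blast
qed

end

section \<open>Generators change active digits\<close>

context spherical_tree
begin

lemma nonzeros_eq_if_zero_between:
  assumes "j \<le> n" "\<forall>i\<in>{j..<n}. x i = 0"
  shows "nonzeros n x = nonzeros j x"
proof -
  have "i < j" if "i < n" "x i \<noteq> 0" for i
    using assms(2) that by (meson atLeastLessThan_iff not_le)
  then have "{i. i < n \<and> x i \<noteq> 0} = {i. i < j \<and> x i \<noteq> 0}"
    using assms(1) by auto
  then show ?thesis by (simp add: nonzeros_def)
qed

text \<open>
  The place at which the generator of index \<open>j - 1\<close> acts is the one right after the nonzero digit number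
  \<open>j\<close>, or the position \<open>0\<close> if \<open>j = 0\<close>.
\<close>

lemma ell_position:
  assumes "ereal (real k) = 1 + ell x (int j - 1)"
  shows "nonzeros k x = j \<and> (k = 0 \<or> x (k - 1) \<noteq> 0)"
  using assms
proof (induction j arbitrary: k)
  case 0
  then have "k = 0" by (simp add: ell_minus_1)
  then show ?case by simp
next
  case (Suc j)
  have "int (Suc j) - 1 = int j" by simp
  then obtain j' n where *: "k = Suc n" "ereal (real j') = 1 + ell x (int j - 1)" "j' \<le> n" "x n \<noteq> 0"
    "\<forall>i\<in>{j'..<n}. x i = 0"
    using Suc.prems ell_rec[of "int j" k x] by (simp only: of_nat_0_le_iff) blast
  then have "nonzeros n x = j" using Suc.IH[of j'] nonzeros_eq_if_zero_between[of j' n x] by simp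
  then show ?case using * by (simp add: nonzeros_Suc)
qed

lemma mother_generator_flips_active_digit:
  assumes "d \<le> 2" "bdd_above (range m)" "g \<in> mother_generators d m" "x \<in> ends m"
  shows "g x = x \<or> (\<exists>k c. active x k \<and> c < m k \<and> g x = x(k := c))"
proof -
  obtain t \<sigma> where g: "g = mother_generator m t \<sigma>" "-1 \<le> t" "t \<le> int d"
    and \<sigma>: "\<And>i. \<sigma> (m i) permutes {..<m i}"
    using mother_generators_cases[OF assms(2,3)] by metis
  show ?thesis
  proof (cases "\<exists>k::nat. ereal (real k) = 1 + ell x t")
    case True
    then obtain k :: nat where k: "ereal (real k) = 1 + ell x t" ..
    then have "ereal (real k) = 1 + ell x (int (nat (t + 1)) - 1)" using g(2) by simp
    then have "active x k"
      using ell_position[of k x "nat (t + 1)"] g(3) assms(1) by (auto simp: active_def)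
    moreover have "\<sigma> (m k) (x k) < m k"
      using permutes_in_image[OF \<sigma>, of k "x k"] assms(4) by (simp add: ends_def)
    moreover have "g x = x(k := \<sigma> (m k) (x k))"
    proof
      fix i
      have "ereal (real i) = 1 + ell x t \<longleftrightarrow> i = k"
        using k ell_unique[of i x t k] by blast
      then show "g x i = (x(k := \<sigma> (m k) (x k))) i"
        using assms(4) by (simp add: g(1) mother_generator_def)
    qed
    ultimately show ?thesis by blast
  next
    case False
    then have "g x = x" using assms(4) by (auto simp: g(1) mother_generator_def)
    then show ?thesis ..
  qed
qed

text \<open>
  Every edge changes a single active digit, and an active digit of a vertex in the tile of level \<open>n\<close> is at
  position at most \<open>n\<close>.
\<close>

lemma generator_energy_bound:
  assumes "d \<le> 2" "bdd_above (range m)" "B \<subseteq> tile n"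
  shows "(\<Sum>x\<in>B. \<Sum>g\<in>mother_generators d m. (f x - f (g x))\<^sup>2)
    \<le> real (card (mother_generators d m)) * energy (Suc n) f"
proof -
  let ?S = "mother_generators d m"
  let ?e = "\<lambda>x. \<Sum>k<Suc n. if active x k then \<Sum>c<m k. (f (x(k := c)) - f x)\<^sup>2 else 0"
  have e_nonneg: "0 \<le> (if active x k then \<Sum>c<m k. (f (x(k := c)) - f x)\<^sup>2 else 0)" for x k
    by (auto intro: sum_nonneg)
  have "(f x - f (g x))\<^sup>2 \<le> ?e x" if g: "g \<in> ?S" and x: "x \<in> tile n" for g x
  proof -
    have "x \<in> ends m" using x by (simp add: tile_def)
    from mother_generator_flips_active_digit[OF assms(1,2) g this]
    consider "g x = x" | k c where "active x k" "c < m k" "g x = x(k := c)" by blast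
    then show ?thesis
    proof cases
      case 1
      then show ?thesis using e_nonneg by (auto intro!: sum_nonneg simp del: sum.lessThan_Suc)
    next
      case (2 k c)
      have "k \<le> n"
      proof (rule ccontr)
        assume "\<not> k \<le> n"
        then have "k \<noteq> 0" "n \<le> k - 1" by auto
        then show False using 2(1) tile_digit[OF x, of "k - 1"] by (simp add: active_def)
      qed
      have "(f x - f (g x))\<^sup>2 = (f (x(k := c)) - f x)\<^sup>2"
        unfolding 2(3) by (rule power2_commute)
      also have "\<dots> \<le> (\<Sum>c<m k. (f (x(k := c)) - f x)\<^sup>2)"
        using 2(2) by (intro member_le_sum) auto
      also have "\<dots> = (if active x k then \<Sum>c<m k. (f (x(k := c)) - f x)\<^sup>2 else 0)"
        using 2(1) by simp
      also have "\<dots> \<le> ?e x"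
        using \<open>k \<le> n\<close> e_nonneg by (intro member_le_sum) auto
      finally show ?thesis .
    qed
  qed
  then have "(\<Sum>x\<in>B. \<Sum>g\<in>?S. (f x - f (g x))\<^sup>2) \<le> (\<Sum>x\<in>B. \<Sum>g\<in>?S. ?e x)"
    using assms(3) by (intro sum_mono) blast
  also have "\<dots> = real (card ?S) * (\<Sum>x\<in>B. ?e x)"
    by (simp only: sum_constant sum_distrib_left)
  also have "(\<Sum>x\<in>B. ?e x) \<le> energy (Suc n) f"
    unfolding energy_def using assms(3) tile_mono[of n "Suc n"] e_nonneg
    by (intro sum_mono2 sum_nonneg) auto
  finally show ?thesis by (simp add: mult_left_mono)
qed

end

lemma mother_generators_bij_finitary:
  assumes "bdd_above (range m)" "g \<in> mother_generators d m"
  shows "bij_betw g (finitary_ends m) (finitary_ends m)"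
proof -
  have b: "bij_betw g (ends m) (ends m)"
    using mother_generators_Bij[OF assms] by (simp add: Bij_def)
  have sub: "finitary_ends m \<subseteq> ends m" by (auto simp: finitary_ends_def)
  have "g ` finitary_ends m = finitary_ends m"
  proof (intro equalityI subsetI)
    fix y assume y: "y \<in> finitary_ends m"
    then have "y \<in> g ` ends m"
      unfolding bij_betw_imp_surj_on[OF b] using sub by (rule subsetD[rotated])
    then obtain x where "x \<in> ends m" "g x = y"
      by (elim imageE) simp
    then show "y \<in> g ` finitary_ends m"
      using mother_generators_finitary_iff[OF assms, of x] y by blast
  next
    fix y assume "y \<in> g ` finitary_ends m"
    then obtain x where x: "x \<in> finitary_ends m" "y = g x"
      by (rule imageE)
    then show "y \<in> finitary_ends m"
      using mother_generators_finitary_iff[OF assms, of x] sub by blast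
  qed
  moreover have "inj_on g (finitary_ends m)"
    using bij_betw_imp_inj_on[OF b] sub by (rule inj_on_subset)
  ultimately show ?thesis by (simp add: bij_betw_def)
qed

theorem theorem1p5:
  fixes d :: nat and m :: "nat \<Rightarrow> nat"
  assumes "d \<in> {0, 1, 2}"
    and "\<And>i. 2 \<le> m i"
    and "bdd_above (range m)"
  shows "recurrent_graph (mother_schreier_graph d m)"
proof -
  obtain M where M: "\<And>i. m i \<le> M"
    using assms(3) by (auto simp: bdd_above_def)
  interpret spherical_tree m M
    using assms(2) M by unfold_locales
  interpret permutation_action "mother_generators d m" "\<lambda>g x. g x" "finitary_ends m"
    using finite_mother_generators[OF assms(3)] mother_generators_nonempty[OF assms(3)]
      mother_generators_bij_finitary[OF assms(3)]
    by unfold_locales auto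
  have d: "d \<le> 2" using assms(1) by auto
  let ?N = "real (card (mother_generators d m))"
  have N: "0 < ?N" using card_S_pos by simp
  show ?thesis
    unfolding mother_schreier_graph_def
  proof (rule recurrent_schreier_graphI)
    fix v and e :: real assume v: "v \<in> finitary_ends m" and e: "0 < e"
    have "0 < e / ?N" using e N by simp
    from low_energy_function[OF v this] obtain f where f:
      "finite {x \<in> finitary_ends m. f x \<noteq> 0}" "1 / 2 \<le> f v" "\<And>n. energy n f \<le> e / ?N"
      by blast
    have "(\<Sum>x\<in>B. \<Sum>g\<in>mother_generators d m. (f x - f (g x))\<^sup>2) \<le> e"
      if B: "finite B" "B \<subseteq> finitary_ends m" for B
    proof -
      obtain n where "B \<subseteq> tile n" using finite_finitary_ends_tile[OF B] ..
      then have "(\<Sum>x\<in>B. \<Sum>g\<in>mother_generators d m. (f x - f (g x))\<^sup>2) \<le> ?N * energy (Suc n) f"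
        by (rule generator_energy_bound[OF d assms(3)])
      also have "\<dots> \<le> ?N * (e / ?N)"
        using f(3) N by (intro mult_left_mono) auto
      finally show ?thesis using N by simp
    qed
    then show "\<exists>f :: (nat \<Rightarrow> nat) \<Rightarrow> real. finite {x \<in> finitary_ends m. f x \<noteq> 0} \<and> 1 / 2 \<le> f v \<and>
      (\<forall>B. finite B \<longrightarrow> B \<subseteq> finitary_ends m \<longrightarrow>
        (\<Sum>x\<in>B. \<Sum>s\<in>mother_generators d m. (f x - f (s x))\<^sup>2) \<le> e)"
      using f(1,2) by blast
  qed
qed

end
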